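(* Let $L$ be a countable first-order language and $n\ge 1$. For every theory $T$ in $L$, either $\alpha_n(T)\le \aleph_0$ or $\alpha_n(T)=2^{\aleph_0}$. Therefore either $\alpha(T)\le\aleph_0$ or $\alpha(T)=2^{\aleph_0}$.
   Context: A theory in $L$ is a set of $L$-sentences. A model $\mathcal M$ is $n$-generated if there is an $n$-tuple $\bar a$ in $\mathcal M$ such that every element of $\mathcal M$ equals $\tau(\bar a)$ for some term $\tau(\bar x)$ of $L$; it is finitely generated if it is $n$-generated for some $n\ge 1$. $\alpha_n(T)$ (resp. $\alpha(T)$) denotes the number of $n$-generated (resp. finitely generated) models of $T$ up to isomorphism. *)

theory Defs
  imports "HOL-Library.Countable_Set"
begin

unbundle cardinal_syntax

section \<open>First-order languages, terms and formulas\<close>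

text \<open>Constant symbols are function symbols of arity 0.  Equality is a logical symbol.\<close>

record ('f, 'r) language =
  fsyms :: "'f set"
  farity :: "'f \<Rightarrow> nat"
  rsyms :: "'r set"
  rarity :: "'r \<Rightarrow> nat"

definition countable_language :: "('f, 'r) language \<Rightarrow> bool" where
  "countable_language L \<longleftrightarrow> countable (fsyms L) \<and> countable (rsyms L)"

datatype 'f trm = Var nat | Fn 'f "'f trm list"

fun tvars :: "'f trm \<Rightarrow> nat set" where
  "tvars (Var i) = {i}"
| "tvars (Fn f ts) = (\<Union>t\<in>set ts. tvars t)"

text \<open>The types \<open>trm\<close> and \<open>form\<close> contain raw syntax; the \<open>L\<close>-terms and \<open>L\<close>-formulas
  are those that use only symbols of \<open>L\<close>, with the right number of arguments.\<close>

fun L_term :: "('f, 'r) language \<Rightarrow> 'f trm \<Rightarrow> bool" where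
  "L_term L (Var i) \<longleftrightarrow> True"
| "L_term L (Fn f ts) \<longleftrightarrow> f \<in> fsyms L \<and> length ts = farity L f \<and> (\<forall>t\<in>set ts. L_term L t)"

text \<open>The connectives and the quantifier that are not listed are definable from these.\<close>

datatype ('f, 'r) form =
    Eq "'f trm" "'f trm"
  | Rel 'r "'f trm list"
  | Neg "('f, 'r) form"
  | Conj "('f, 'r) form" "('f, 'r) form"
  | Exist nat "('f, 'r) form"

primrec L_formula :: "('f, 'r) language \<Rightarrow> ('f, 'r) form \<Rightarrow> bool" where
  "L_formula L (Eq s t) \<longleftrightarrow> L_term L s \<and> L_term L t"
| "L_formula L (Rel R ts) \<longleftrightarrow> R \<in> rsyms L \<and> length ts = rarity L R \<and> (\<forall>t\<in>set ts. L_term L t)"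
| "L_formula L (Neg p) \<longleftrightarrow> L_formula L p"
| "L_formula L (Conj p q) \<longleftrightarrow> L_formula L p \<and> L_formula L q"
| "L_formula L (Exist i p) \<longleftrightarrow> L_formula L p"

primrec free_vars :: "('f, 'r) form \<Rightarrow> nat set" where
  "free_vars (Eq s t) = tvars s \<union> tvars t"
| "free_vars (Rel R ts) = (\<Union>t\<in>set ts. tvars t)"
| "free_vars (Neg p) = free_vars p"
| "free_vars (Conj p q) = free_vars p \<union> free_vars q"
| "free_vars (Exist i p) = free_vars p - {i}"

definition L_sentence :: "('f, 'r) language \<Rightarrow> ('f, 'r) form \<Rightarrow> bool" where
  "L_sentence L p \<longleftrightarrow> L_formula L p \<and> free_vars p = {}"

definition L_theory :: "('f, 'r) language \<Rightarrow> ('f, 'r) form set \<Rightarrow> bool" where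
  "L_theory L T \<longleftrightarrow> (\<forall>p\<in>T. L_sentence L p)"

section \<open>Structures and satisfaction\<close>

text \<open>The interpretations are total HOL functions, but only their values at symbols of \<open>L\<close> and at
  argument lists of the right length from the universe matter; in particular the notion of
  isomorphism below ignores all other values.\<close>

record ('f, 'r, 'u) fo_structure =
  universe :: "'u set"
  fint :: "'f \<Rightarrow> 'u list \<Rightarrow> 'u"
  rint :: "'r \<Rightarrow> 'u list \<Rightarrow> bool"

definition L_structure :: "('f, 'r) language \<Rightarrow> ('f, 'r, 'u) fo_structure \<Rightarrow> bool" where
  "L_structure L M \<longleftrightarrow> universe M \<noteq> {} \<and>
     (\<forall>f\<in>fsyms L. \<forall>xs. length xs = farity L f \<longrightarrow> set xs \<subseteq> universe M \<longrightarrow> fint M f xs \<in> universe M)"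

primrec teval :: "('f, 'r, 'u) fo_structure \<Rightarrow> (nat \<Rightarrow> 'u) \<Rightarrow> 'f trm \<Rightarrow> 'u" where
  "teval M e (Var i) = e i"
| "teval M e (Fn f ts) = fint M f (map (teval M e) ts)"

primrec sat :: "('f, 'r, 'u) fo_structure \<Rightarrow> (nat \<Rightarrow> 'u) \<Rightarrow> ('f, 'r) form \<Rightarrow> bool" where
  "sat M e (Eq s t) \<longleftrightarrow> teval M e s = teval M e t"
| "sat M e (Rel R ts) \<longleftrightarrow> rint M R (map (teval M e) ts)"
| "sat M e (Neg p) \<longleftrightarrow> \<not> sat M e p"
| "sat M e (Conj p q) \<longleftrightarrow> sat M e p \<and> sat M e q"
| "sat M e (Exist i p) \<longleftrightarrow> (\<exists>x\<in>universe M. sat M (e(i := x)) p)"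

definition is_model ::
    "('f, 'r) language \<Rightarrow> ('f, 'r) form set \<Rightarrow> ('f, 'r, 'u) fo_structure \<Rightarrow> bool" where
  "is_model L T M \<longleftrightarrow> L_structure L M \<and> (\<forall>p\<in>T. \<forall>e. range e \<subseteq> universe M \<longrightarrow> sat M e p)"

definition isomorphic ::
    "('f, 'r) language \<Rightarrow> ('f, 'r, 'u) fo_structure \<Rightarrow> ('f, 'r, 'v) fo_structure \<Rightarrow> bool" where
  "isomorphic L M N \<longleftrightarrow> (\<exists>h. bij_betw h (universe M) (universe N) \<and>
     (\<forall>f\<in>fsyms L. \<forall>xs. length xs = farity L f \<longrightarrow> set xs \<subseteq> universe M \<longrightarrow>
        h (fint M f xs) = fint N f (map h xs)) \<and>
     (\<forall>R\<in>rsyms L. \<forall>xs. length xs = rarity L R \<longrightarrow> set xs \<subseteq> universe M \<longrightarrow>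
        (rint M R xs \<longleftrightarrow> rint N R (map h xs))))"

section \<open>Finitely generated models and their number\<close>

text \<open>The tuple is the list \<open>a\<close>, assigned to the variables \<open>0, \<dots>, n - 1\<close>;
  the values of \<open>(!) a\<close> beyond the length of \<open>a\<close> are never used.\<close>

definition n_generated ::
    "('f, 'r) language \<Rightarrow> nat \<Rightarrow> ('f, 'r, 'u) fo_structure \<Rightarrow> bool" where
  "n_generated L n M \<longleftrightarrow> (\<exists>a. length a = n \<and> set a \<subseteq> universe M \<and>
     (\<forall>b\<in>universe M. \<exists>t. L_term L t \<and> tvars t \<subseteq> {..<n} \<and> b = teval M ((!) a) t))"

definition finitely_generated ::
    "('f, 'r) language \<Rightarrow> ('f, 'r, 'u) fo_structure \<Rightarrow> bool" where
  "finitely_generated L M \<longleftrightarrow> (\<exists>n\<ge>1. n_generated L n M)"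

definition iso_rel ::
    "('f, 'r) language \<Rightarrow> ('f, 'r, 'u) fo_structure set \<Rightarrow> ('f, 'r, 'u) fo_structure rel" where
  "iso_rel L K = {(M, N). M \<in> K \<and> N \<in> K \<and> isomorphic L M N}"

text \<open>The class of all models of \<open>T\<close> is not a set, so isomorphism types are counted among the models
  whose universe is a set of elements of a type \<open>'u\<close>.  When \<open>L\<close> is countable and \<open>'u\<close> is infinite
  this loses nothing: by \<open>finitely_generated_has_copy\<close> and \<open>n_generated_has_copy\<close> below,
  every such model, over any type whatsoever, has an isomorphic copy over \<open>'u\<close>.\<close>

definition alpha_n ::
    "('f, 'r) language \<Rightarrow> nat \<Rightarrow> ('f, 'r) form set \<Rightarrow> ('f, 'r, 'u) fo_structure set rel" where
  "alpha_n L n T =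
     (let K = {M. is_model L T M \<and> n_generated L n M} in |K // iso_rel L K| )"

definition alpha ::
    "('f, 'r) language \<Rightarrow> ('f, 'r) form set \<Rightarrow> ('f, 'r, 'u) fo_structure set rel" where
  "alpha L T =
     (let K = {M. is_model L T M \<and> finitely_generated L M} in |K // iso_rel L K| )"

section \<open>The choice of the type of elements is immaterial\<close>

lemma iso_refl: "isomorphic L M M"
  unfolding isomorphic_def by (rule exI[of _ id]) (auto simp: bij_betw_def)

lemma teval_in:
  assumes "L_structure L M" "L_term L t" "\<And>i. i \<in> tvars t \<Longrightarrow> e i \<in> universe M"
  shows "teval M e t \<in> universe M"
  using assms(2,3)
proof (induction t)
  case (Fn f ts)
  then have "set (map (teval M e) ts) \<subseteq> universe M" by auto
  with Fn.prems assms(1) show ?case by (auto simp: L_structure_def)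
qed simp

lemma iso_sym:
  assumes M: "L_structure L M" and i: "isomorphic L M N"
  shows "isomorphic L N M"
proof -
  obtain h where h: "bij_betw h (universe M) (universe N)"
    and hf: "\<And>f xs. \<lbrakk>f \<in> fsyms L; length xs = farity L f; set xs \<subseteq> universe M\<rbrakk> \<Longrightarrow>
        h (fint M f xs) = fint N f (map h xs)"
    and hr: "\<And>R xs. \<lbrakk>R \<in> rsyms L; length xs = rarity L R; set xs \<subseteq> universe M\<rbrakk> \<Longrightarrow>
        rint M R xs \<longleftrightarrow> rint N R (map h xs)"
    using i unfolding isomorphic_def by blast
  define g where "g = inv_into (universe M) h"
  have g: "bij_betw g (universe N) (universe M)"
    unfolding g_def by (rule bij_betw_inv_into[OF h])
  have gin: "set (map g ys) \<subseteq> universe M" if "set ys \<subseteq> universe N" for ys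
    using that g by (auto simp: bij_betw_def)
  have hg: "map h (map g ys) = ys" if "set ys \<subseteq> universe N" for ys
    using that h by (induction ys) (auto simp: g_def bij_betw_inv_into_right)
  have gh: "g (h x) = x" if "x \<in> universe M" for x
    using that h by (simp add: g_def bij_betw_inv_into_left)
  have "g (fint N f ys) = fint M f (map g ys)"
    if a: "f \<in> fsyms L" "length ys = farity L f" "set ys \<subseteq> universe N" for f ys
  proof -
    have "fint M f (map g ys) \<in> universe M"
      using M a gin[OF a(3)] by (simp add: L_structure_def)
    moreover have "h (fint M f (map g ys)) = fint N f ys"
      using hf[of f "map g ys"] a gin[OF a(3)] hg[OF a(3)] by simp
    ultimately show ?thesis using gh by metis
  qed
  moreover have "rint N R ys \<longleftrightarrow> rint M R (map g ys)"
    if a: "R \<in> rsyms L" "length ys = rarity L R" "set ys \<subseteq> universe N" for R ys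
    using hr[of R "map g ys"] a gin[OF a(3)] hg[OF a(3)] by simp
  ultimately show ?thesis unfolding isomorphic_def using g by blast
qed

lemma iso_trans:
  assumes "isomorphic L M N" "isomorphic L N P"
  shows "isomorphic L M P"
proof -
  obtain h where h: "bij_betw h (universe M) (universe N)"
    and hf: "\<And>f xs. \<lbrakk>f \<in> fsyms L; length xs = farity L f; set xs \<subseteq> universe M\<rbrakk> \<Longrightarrow>
        h (fint M f xs) = fint N f (map h xs)"
    and hr: "\<And>R xs. \<lbrakk>R \<in> rsyms L; length xs = rarity L R; set xs \<subseteq> universe M\<rbrakk> \<Longrightarrow>
        rint M R xs \<longleftrightarrow> rint N R (map h xs)"
    using assms(1) unfolding isomorphic_def by blast
  obtain k where k: "bij_betw k (universe N) (universe P)"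
    and kf: "\<And>f xs. \<lbrakk>f \<in> fsyms L; length xs = farity L f; set xs \<subseteq> universe N\<rbrakk> \<Longrightarrow>
        k (fint N f xs) = fint P f (map k xs)"
    and kr: "\<And>R xs. \<lbrakk>R \<in> rsyms L; length xs = rarity L R; set xs \<subseteq> universe N\<rbrakk> \<Longrightarrow>
        rint N R xs \<longleftrightarrow> rint P R (map k xs)"
    using assms(2) unfolding isomorphic_def by blast
  have hin: "set (map h xs) \<subseteq> universe N" if "set xs \<subseteq> universe M" for xs
    using that h by (auto simp: bij_betw_def)
  show ?thesis
    unfolding isomorphic_def
  proof (intro exI[of _ "k \<circ> h"] conjI ballI allI impI)
    show "bij_betw (k \<circ> h) (universe M) (universe P)" by (rule bij_betw_trans[OF h k])
  next
    fix f xs assume a: "f \<in> fsyms L" "length xs = farity L f" "set xs \<subseteq> universe M"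
    show "(k \<circ> h) (fint M f xs) = fint P f (map (k \<circ> h) xs)"
      using hf[OF a] kf[of f "map h xs"] a hin[OF a(3)] by simp
  next
    fix R xs assume a: "R \<in> rsyms L" "length xs = rarity L R" "set xs \<subseteq> universe M"
    show "rint M R xs \<longleftrightarrow> rint P R (map (k \<circ> h) xs)"
      using hr[OF a] kr[of R "map h xs"] a hin[OF a(3)] by simp
  qed
qed

lemma equiv_iso_rel:
  assumes "\<And>M. M \<in> K \<Longrightarrow> L_structure L M"
  shows "equiv K (iso_rel L K)"
  unfolding equiv_def refl_on_def sym_on_def trans_on_def iso_rel_def
  using iso_refl iso_sym[OF assms] iso_trans by blast

lemma iso_transfer:
  assumes T: "L_theory L T" and M: "is_model L T M" and i: "isomorphic L M N"
  shows "is_model L T N" and "n_generated L n M \<Longrightarrow> n_generated L n N"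
proof -
  have sM: "L_structure L M" using M by (simp add: is_model_def)
  obtain h where h: "bij_betw h (universe M) (universe N)"
    and hf: "\<And>f xs. \<lbrakk>f \<in> fsyms L; length xs = farity L f; set xs \<subseteq> universe M\<rbrakk> \<Longrightarrow>
        h (fint M f xs) = fint N f (map h xs)"
    and hr: "\<And>R xs. \<lbrakk>R \<in> rsyms L; length xs = rarity L R; set xs \<subseteq> universe M\<rbrakk> \<Longrightarrow>
        rint M R xs \<longleftrightarrow> rint N R (map h xs)"
    using i unfolding isomorphic_def by blast
  define g where "g = inv_into (universe M) h"
  have g: "g y \<in> universe M" "h (g y) = y" if "y \<in> universe N" for y
    using that h by (auto simp: g_def bij_betw_def inv_into_into f_inv_into_f)
  have inj: "inj_on h (universe M)" and hin: "\<And>x. x \<in> universe M \<Longrightarrow> h x \<in> universe N"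
    using h by (auto simp: bij_betw_def)
  have te: "h (teval M e t) = teval N e' t"
    if "L_term L t" "\<And>i. i \<in> tvars t \<Longrightarrow> e i \<in> universe M \<and> e' i = h (e i)" for e e' t
    using that
  proof (induction t)
    case (Fn f ts)
    have "set (map (teval M e) ts) \<subseteq> universe M"
      using Fn.prems teval_in[OF sM] by fastforce
    then have "h (teval M e (Fn f ts)) = fint N f (map h (map (teval M e) ts))"
      using hf[of f "map (teval M e) ts"] Fn.prems by simp
    also have "map h (map (teval M e) ts) = map (teval N e') ts"
      using Fn by auto
    finally show ?case by simp
  qed simp
  have sat: "sat M e p \<longleftrightarrow> sat N (h \<circ> e) p"
    if "L_formula L p" "range e \<subseteq> universe M" for e p
    using that
  proof (induction p arbitrary: e)
    case (Eq s t)
    have "h (teval M e s) = teval N (h \<circ> e) s" "h (teval M e t) = teval N (h \<circ> e) t"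
      using Eq by (auto intro!: te)
    moreover have "teval M e s \<in> universe M" "teval M e t \<in> universe M"
      using Eq by (auto intro!: teval_in[OF sM])
    ultimately show ?case using inj_on_eq_iff[OF inj] by (metis sat.simps(1))
  next
    case (Rel R ts)
    have 1: "set (map (teval M e) ts) \<subseteq> universe M"
      using Rel by (auto intro!: teval_in[OF sM])
    have 2: "map h (map (teval M e) ts) = map (teval N (h \<circ> e)) ts"
      using Rel by (auto intro!: te)
    have "rint M R (map (teval M e) ts) \<longleftrightarrow> rint N R (map h (map (teval M e) ts))"
      using Rel.prems by (intro hr 1) auto
    then show ?case unfolding 2 by (simp only: sat.simps)
  next
    case (Exist i p)
    have up: "h \<circ> e(i := x) = (h \<circ> e)(i := h x)" for x by auto
    have "sat M (e(i := x)) p \<longleftrightarrow> sat N ((h \<circ> e)(i := h x)) p" if "x \<in> universe M" for x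
    proof -
      have "range (e(i := x)) \<subseteq> universe M" using Exist.prems that by auto
      moreover have "L_formula L p" using Exist.prems by simp
      ultimately show ?thesis using Exist.IH unfolding up[symmetric] by blast
    qed
    moreover have "universe N = h ` universe M" using h by (auto simp: bij_betw_def)
    ultimately show ?case unfolding sat.simps by (metis (no_types, lifting) image_iff)
  qed auto
  have sN: "L_structure L N"
    unfolding L_structure_def
  proof (intro conjI ballI allI impI)
    show "universe N \<noteq> {}" using sM h by (auto simp: L_structure_def bij_betw_def)
  next
    fix f ys assume a: "f \<in> fsyms L" "length ys = farity L f" "set ys \<subseteq> universe N"
    have 1: "set (map g ys) \<subseteq> universe M" using a g by auto
    have 2: "map h (map g ys) = ys" using a(3) g(2) by (induction ys) auto
    have "fint M f (map g ys) \<in> universe M" using 1 a sM by (auto simp: L_structure_def)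
    then show "fint N f ys \<in> universe N" using hf[OF a(1) _ 1] a 2 hin by fastforce
  qed
  have "sat N e p" if p: "p \<in> T" and e: "range e \<subseteq> universe N" for e p
  proof -
    have "range (g \<circ> e) \<subseteq> universe M" "h \<circ> (g \<circ> e) = e" using e g by (simp_all add: fun_eq_iff image_subset_iff)
    moreover have "L_formula L p" using T p by (auto simp: L_theory_def L_sentence_def)
    ultimately show ?thesis using sat[of p "g \<circ> e"] M p by (auto simp: is_model_def)
  qed
  with sN show "is_model L T N" by (simp add: is_model_def)
  show "n_generated L n N" if gM: "n_generated L n M"
  proof -
    obtain a where a: "length a = n" "set a \<subseteq> universe M"
      and gen: "\<And>b. b \<in> universe M \<Longrightarrow> \<exists>t. L_term L t \<and> tvars t \<subseteq> {..<n} \<and> b = teval M ((!) a) t"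
      using gM unfolding n_generated_def by blast
    have "\<exists>t. L_term L t \<and> tvars t \<subseteq> {..<n} \<and> b = teval N ((!) (map h a)) t"
      if b: "b \<in> universe N" for b
    proof -
      obtain t where t: "L_term L t" "tvars t \<subseteq> {..<n}" "g b = teval M ((!) a) t"
        using gen g(1)[OF b] by blast
      have "h (teval M ((!) a) t) = teval N ((!) (map h a)) t"
        using t a by (intro te) (auto simp: subset_iff)
      with t g(2)[OF b] show ?thesis by metis
    qed
    moreover have "set (map h a) \<subseteq> universe N" using a hin by auto
    ultimately show ?thesis unfolding n_generated_def using a(1) by (metis length_map)
  qed
qed

lemma countable_L_terms:
  assumes "countable_language L"
  shows "countable {t. L_term L t}"
proof -
  define I :: "nat \<Rightarrow> _" where
    "I k = rec_nat (range Var) (\<lambda>_ S. S \<union> (\<lambda>(f, ts). Fn f ts) ` (fsyms L \<times> lists S)) k" for k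
  have S: "I (Suc k) = I k \<union> (\<lambda>(f, ts). Fn f ts) ` (fsyms L \<times> lists (I k))" for k
    by (simp add: I_def)
  have cnt: "countable (I k)" for k
  proof (induction k)
    case 0 show ?case by (simp add: I_def)
  next
    case (Suc k)
    then show ?case using assms unfolding S countable_language_def by auto
  qed
  have mono: "I j \<subseteq> I k" if "j \<le> k" for j k
    by (rule lift_Suc_mono_le[OF _ that]) (auto simp: S)
  have "\<exists>k. t \<in> I k" if "L_term L t" for t
    using that
  proof (induction t)
    case (Var i) show ?case by (rule exI[of _ 0]) (simp add: I_def)
  next
    case (Fn f ts)
    then have "\<forall>t\<in>set ts. \<exists>k. t \<in> I k" by auto
    then obtain k where k: "\<forall>t\<in>set ts. t \<in> I (k t)" by metis
    have "t \<in> I (Max (k ` set ts))" if "t \<in> set ts" for t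
      using k that mono[of "k t" "Max (k ` set ts)"] by auto
    then have "Fn f ts \<in> I (Suc (Max (k ` set ts)))"
      using Fn.prems unfolding S by (auto simp: lists_eq_set)
    then show ?case ..
  qed
  then have "{t. L_term L t} \<subseteq> (\<Union>k. I k)" by auto
  with cnt show ?thesis by (meson countable_UN countable_subset countableI_type)
qed

lemma n_generated_has_copy:
  fixes M :: "('f, 'r, 'v) fo_structure"
  assumes inf: "infinite (UNIV :: 'u set)" and L: "countable_language L" and T: "L_theory L T"
    and M: "is_model L T M" and gen: "n_generated L n M"
  shows "\<exists>N :: ('f, 'r, 'u) fo_structure. is_model L T N \<and> n_generated L n N \<and> isomorphic L M N"
proof -
  obtain a where "universe M \<subseteq> teval M ((!) a) ` {t. L_term L t}"
    using gen unfolding n_generated_def by blast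
  then have "countable (universe M)"
    by (rule countable_subset) (rule countable_image[OF countable_L_terms[OF L]])
  then obtain u :: "'v \<Rightarrow> nat" where u: "inj_on u (universe M)" by (auto simp: countable_def)
  obtain v :: "nat \<Rightarrow> 'u" where v: "inj v" using inf infinite_countable_subset by blast
  define h where "h = v \<circ> u"
  have h: "inj_on h (universe M)"
    unfolding h_def using u v by (intro comp_inj_on) (auto intro: inj_on_subset)
  define g where "g = inv_into (universe M) h"
  have gh: "map g (map h xs) = xs" if "set xs \<subseteq> universe M" for xs
    using that h by (induction xs) (auto simp: g_def)
  define N :: "('f, 'r, 'u) fo_structure" where
    "N = \<lparr>universe = h ` universe M, fint = (\<lambda>f ys. h (fint M f (map g ys))),
          rint = (\<lambda>R ys. rint M R (map g ys))\<rparr>"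
  have "isomorphic L M N"
    unfolding isomorphic_def
  proof (intro exI[of _ h] conjI ballI allI impI)
    show "bij_betw h (universe M) (universe N)" using h by (simp add: bij_betw_def N_def)
  qed (use gh in \<open>simp_all add: N_def del: map_map\<close>)
  with iso_transfer[OF T M] gen show ?thesis by blast
qed

lemma finitely_generated_has_copy:
  fixes M :: "('f, 'r, 'v) fo_structure"
  assumes "infinite (UNIV :: 'u set)" and "countable_language L" and "L_theory L T"
    and "is_model L T M" and "finitely_generated L M"
  shows "\<exists>N :: ('f, 'r, 'u) fo_structure. is_model L T N \<and> finitely_generated L N \<and> isomorphic L M N"
  using n_generated_has_copy[OF assms(1-4)] assms(5) unfolding finitely_generated_def by metis

end

theory Submission
  imports Defs "HOL-Analysis.Analysis"
begin

text \<open>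
  A model \<open>M\<close> together with a generating \<open>n\<close>-tuple \<open>a\<close> is determined up to isomorphism by its atomic
  diagram: the set of atomic formulas in \<open>n\<close> variables that \<open>a\<close> satisfies.  So the isomorphism types of
  \<open>n\<close>-generated models of \<open>T\<close> are the images of the points of a set \<open>X\<close> of subsets of a countable set.
  Two observations replace any general theory of Borel equivalence relations.

  The map from \<open>X\<close> to isomorphism types has countable fibres: a finitely generated model is countable,
  hence has only countably many generating \<open>n\<close>-tuples, and every diagram that yields its isomorphism
  type is the diagram of one of these tuples (lemma \<open>iso_classes_countable_or_continuum\<close>).

  The set \<open>X\<close> is Borel.  A set \<open>x\<close> of atomic formulas is a diagram iff it obeys the laws of equality,
  and then it is the diagram of the structure of terms modulo \<open>x\<close>.  Since every element of that structure
  is named by a term, an existential quantifier amounts to a countable union over terms, so that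
  the truth of each formula in the structure is a Borel condition on \<open>x\<close>, by induction on
  the formula (lemmas \<open>sat_term_structure_Borel\<close> and \<open>diagrams_of_models\<close>).

  A Borel set is countable or contains a copy of the Cantor space, and so has the cardinality
  of the continuum (lemmas \<open>Borel_imp_analytic\<close> and \<open>analytic_perfect_set\<close>).  In the first case there are
  countably many isomorphism types.  In the second, the continuum is covered by the countable fibres,
  which forces continuum many fibres (lemma \<open>Borel_image_countable_or_continuum\<close>).  The
  statement on all finitely generated models follows, since their isomorphism types are
  the union over \<open>n \<ge> 1\<close> of those of the \<open>n\<close>-generated models.
\<close>

section \<open>Analytic sets\<close>

text \<open>Asking for continuity on the whole Baire space, rather than on the closed set only, spares all
  extension arguments; allowing a closed set, rather than the whole space, as domain makes the empty
  set and intersections no special cases.\<close>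
definition analytic :: "('i \<Rightarrow> bool) set \<Rightarrow> bool" where
  "analytic A \<longleftrightarrow> (\<exists>F (f :: (nat \<Rightarrow> nat) \<Rightarrow> 'i \<Rightarrow> bool). closed F \<and> continuous_on UNIV f \<and> A = f ` F)"

lemma continuous_on_locally_indexed:
  fixes f :: "nat \<Rightarrow> (nat \<Rightarrow> nat) \<Rightarrow> 'a::topological_space"
  assumes "\<And>i. continuous_on UNIV (f i)"
  shows "continuous_on UNIV (\<lambda>z. f (z k) z)"
proof -
  have "continuous_on (\<Union>i. {z. z k = i}) (\<lambda>z. f (z k) z)"
  proof (rule continuous_on_open_UN)
    fix i
    show "open {z :: nat \<Rightarrow> nat. z k = i}"
      using open_vimage[OF open_discrete[of "{i}"] continuous_on_product_coordinates[of k]]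
      by (simp add: vimage_def)
    have "continuous_on {z. z k = i} (f i)"
      using assms continuous_on_subset by blast
    then show "continuous_on {z. z k = i} (\<lambda>z. f (z k) z)"
      by (rule continuous_on_eq) simp
  qed
  moreover have "(\<Union>i. {z. z k = i}) = (UNIV :: (nat \<Rightarrow> nat) set)" by auto
  ultimately show ?thesis by simp
qed

lemma continuous_on_reindex:
  "continuous_on UNIV (\<lambda>z :: nat \<Rightarrow> nat. \<lambda>k. z (h k))"
  by (intro continuous_on_coordinatewise_then_product continuous_on_product_coordinates)

text \<open>The first coordinate of a point selects one of the sets, and the remaining coordinates
  represent a point of it.\<close>
lemma analytic_Union:
  assumes "\<And>i :: nat. analytic (A i)"
  shows "analytic (\<Union>i. A i)"
proof -
  obtain F f where F: "\<And>i. closed (F i)"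
    and f: "\<And>i. continuous_on UNIV (f i :: (nat \<Rightarrow> nat) \<Rightarrow> _)" and A: "\<And>i. A i = f i ` F i"
    using assms unfolding analytic_def by metis
  define tail where "tail z = (\<lambda>k. z (Suc k))" for z :: "nat \<Rightarrow> nat"
  have tail: "continuous_on UNIV tail"
    unfolding tail_def by (rule continuous_on_reindex)
  define G where "G = {z. tail z \<in> F (z 0)}"
  have "closed G"
  proof -
    have "- G = (\<Union>i. (\<lambda>z. z 0) -` {i} \<inter> tail -` (- F i))" by (auto simp: G_def)
    also have "open \<dots>"
      using F by (intro open_UN ballI open_Int open_vimage tail open_discrete
          continuous_on_product_coordinates open_Compl)
    finally show ?thesis by (simp add: closed_open)
  qed
  moreover have "continuous_on UNIV (\<lambda>z. f (z 0) (tail z))"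
    by (rule continuous_on_locally_indexed[where f = "\<lambda>i z. f i (tail z)"])
      (rule continuous_on_compose2[OF f tail subset_UNIV])
  moreover have "(\<Union>i. A i) = (\<lambda>z. f (z 0) (tail z)) ` G"
  proof (intro equalityI subsetI)
    fix x assume "x \<in> (\<Union>i. A i)"
    then obtain i y where y: "y \<in> F i" "x = f i y" using A by auto
    show "x \<in> (\<lambda>z. f (z 0) (tail z)) ` G"
      using y by (intro image_eqI[of _ _ "case_nat i y"]) (simp_all add: G_def tail_def)
  qed (auto simp: A G_def)
  ultimately show ?thesis unfolding analytic_def by blast
qed

text \<open>A point of the Baire space is read as a sequence of points, one for each set, and the closed
  set requires that all of them represent the same point.\<close>
lemma analytic_Inter:
  assumes "\<And>i :: nat. analytic (A i)"
  shows "analytic (\<Inter>i. A i)"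
proof -
  obtain F f where F: "\<And>i. closed (F i)"
    and f: "\<And>i. continuous_on UNIV (f i :: (nat \<Rightarrow> nat) \<Rightarrow> _)" and A: "\<And>i. A i = f i ` F i"
    using assms unfolding analytic_def by metis
  define row where "row i z = (\<lambda>k. z (prod_encode (i, k)))" for i and z :: "nat \<Rightarrow> nat"
  have row: "continuous_on UNIV (row i)" for i
    unfolding row_def by (rule continuous_on_reindex)
  have f_row: "continuous_on UNIV (\<lambda>z. f i (row i z))" for i
    by (rule continuous_on_compose2[OF f row subset_UNIV])
  define G where "G = {z. \<forall>i. row i z \<in> F i \<and> f i (row i z) = f 0 (row 0 z)}"
  have "closed {z. row i z \<in> F i}" for i
    using closed_vimage[OF F row] by (simp add: vimage_def)
  moreover have "closed {z. f i (row i z) = f 0 (row 0 z)}" for i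
    unfolding fun_eq_iff
    by (intro closed_Collect_all closed_Collect_eq continuous_on_product_then_coordinatewise[OF f_row])
  ultimately have "closed G"
    unfolding G_def by (intro closed_Collect_all closed_Collect_conj)
  moreover have "(\<Inter>i. A i) = (\<lambda>z. f 0 (row 0 z)) ` G"
  proof (intro equalityI subsetI)
    fix x assume "x \<in> (\<Inter>i. A i)"
    then have "\<forall>i. \<exists>y. y \<in> F i \<and> x = f i y" using A by auto
    then obtain y where y: "\<And>i. y i \<in> F i" "\<And>i. x = f i (y i)" by metis
    define z where "z k = (case prod_decode k of (i, j) \<Rightarrow> y i j)" for k
    have "row i z = y i" for i by (simp add: row_def z_def)
    then show "x \<in> (\<lambda>z. f 0 (row 0 z)) ` G"
      using y by (intro image_eqI[of _ _ z]) (auto simp: G_def)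
  next
    fix x assume "x \<in> (\<lambda>z. f 0 (row 0 z)) ` G"
    then obtain z where "z \<in> G" "x = f 0 (row 0 z)" by auto
    then have "row i z \<in> F i \<and> x = f i (row i z)" for i unfolding G_def mem_Collect_eq by metis
    then show "x \<in> (\<Inter>i. A i)" unfolding A by blast
  qed
  ultimately show ?thesis unfolding analytic_def using f_row by blast
qed

section \<open>Borel sets of the Cantor space are analytic\<close>

text \<open>The Borel space of the subsets of \<open>I\<close>, given as predicates that are false outside \<open>I\<close>.  The
  generators depend on the coordinates in \<open>I\<close> only, hence for countable \<open>I\<close> these are the Borel sets of the
  Cantor space, whatever the cardinality of the type \<open>'i\<close>.\<close>
definition cantor :: "'i set \<Rightarrow> ('i \<Rightarrow> bool) measure" where
  "cantor I = sigma {x. \<forall>i. x i \<longrightarrow> i \<in> I} {{x. (\<forall>i. x i \<longrightarrow> i \<in> I) \<and> x j} | j. j \<in> I}"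

lemma space_cantor: "space (cantor I) = {x. \<forall>i. x i \<longrightarrow> i \<in> I}"
  by (simp add: cantor_def space_measure_of_conv)

lemma sets_cantor:
  "sets (cantor I) = sigma_sets (space (cantor I)) {{x \<in> space (cantor I). x j} | j. j \<in> I}"
  unfolding space_cantor unfolding cantor_def by (subst sets_measure_of) auto

lemma sets_cantor_coordinate: "{x \<in> space (cantor I). x j} \<in> sets (cantor I)"
proof (cases "j \<in> I")
  case True
  then show ?thesis unfolding sets_cantor by (intro sigma_sets.Basic) auto
next
  case False
  then have "{x \<in> space (cantor I). x j} = {}" by (auto simp: space_cantor)
  then show ?thesis by (simp only: sets.empty_sets)
qed

lemma analytic_cantor_cylinder:
  assumes I: "countable I" and j: "j \<in> I"
  shows "analytic {x \<in> space (cantor I). x j = b}"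
proof -
  define f where "f z = (\<lambda>i. i \<in> I \<and> z (to_nat_on I i) = 0)" for z :: "nat \<Rightarrow> nat"
  have [simp]: "continuous_on UNIV (\<lambda>z :: nat \<Rightarrow> nat. z k = 0)" for k
    by (rule continuous_on_locally_indexed[where f = "\<lambda>i _. i = 0"]) simp
  have f: "continuous_on UNIV f"
    unfolding f_def
  proof (rule continuous_on_coordinatewise_then_product)
    fix i show "continuous_on UNIV (\<lambda>z :: nat \<Rightarrow> nat. i \<in> I \<and> z (to_nat_on I i) = 0)"
      by (cases "i \<in> I") simp_all
  qed
  have "closed (f -` {x. x j = b})"
    using closed_Collect_eq[OF continuous_on_product_then_coordinatewise[OF f, of j] continuous_on_const[of _ b]]
    by (simp add: vimage_def)
  moreover have "{x \<in> space (cantor I). x j = b} = f ` (f -` {x. x j = b})"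
  proof (intro equalityI subsetI)
    fix x assume x: "x \<in> {x \<in> space (cantor I). x j = b}"
    define z where "z k = (if x (from_nat_into I k) then 0 else 1 :: nat)" for k
    have "f z = x" using x I j by (auto simp: f_def z_def space_cantor fun_eq_iff)
    then show "x \<in> f ` (f -` {x. x j = b})" using x by blast
  qed (auto simp: f_def space_cantor)
  ultimately show ?thesis using f unfolding analytic_def by blast
qed

text \<open>Analytic sets are not closed under complements, so the induction shows that the set and its
  complement are both analytic.\<close>
lemma Borel_imp_analytic:
  assumes I: "countable I" "I \<noteq> {}" and X: "X \<in> sets (cantor I)"
  shows "analytic X"
proof -
  let ?S = "space (cantor I)"
  have "analytic X \<and> analytic (?S - X)"
    using X unfolding sets_cantor
  proof (induction rule: sigma_sets.induct)
    case (Basic A)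
    then obtain j where j: "j \<in> I" "A = {x \<in> ?S. x j = True}" by auto
    then have "?S - A = {x \<in> ?S. x j = False}" by auto
    then show ?case
      using analytic_cantor_cylinder[OF I(1) j(1), of True] analytic_cantor_cylinder[OF I(1) j(1), of False] j(2)
      by simp
  next
    case Empty
    obtain j where j: "j \<in> I" using I(2) by auto
    have "analytic ({} :: ('a \<Rightarrow> bool) set)"
      unfolding analytic_def
      by (intro exI[of _ "{}"] exI[of _ "\<lambda>_ _. False"]) simp
    \<comment> \<open>The whole space is split by the value of one coordinate, indexed by naturals with 0 for true.\<close>
    moreover have "analytic (\<Union>b. {x \<in> ?S. x j = (b = (0::nat))})"
      by (rule analytic_Union) (rule analytic_cantor_cylinder[OF I(1) j])
    moreover have "(\<Union>b. {x \<in> ?S. x j = (b = (0::nat))}) = ?S"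
      by auto
    ultimately show ?case by simp
  next
    case (Compl A)
    moreover have "?S - (?S - A) = A"
      using sigma_sets_into_sp[OF _ Compl(1)] by blast
    ultimately show ?case by simp
  next
    case (Union A)
    have "?S - (\<Union>i. A i) = (\<Inter>i. ?S - A i)" by auto
    then show ?case using Union.IH analytic_Union[of A] analytic_Inter[of "\<lambda>i. ?S - A i"] by metis
  qed
  then show ?thesis ..
qed

section \<open>The perfect set property\<close>
lemma open_contains_cylinder:
  fixes U :: "(nat \<Rightarrow> 'b::topological_space) set"
  assumes "open U" "z \<in> U"
  shows "\<exists>m. \<forall>w. (\<forall>k<m. w k = z k) \<longrightarrow> w \<in> U"
proof -
  obtain X where X: "z \<in> Pi\<^sub>E UNIV X" "finite {i. X i \<noteq> UNIV}" "Pi\<^sub>E UNIV X \<subseteq> U"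
    using product_topology_open_contains_basis[of "\<lambda>_. euclidean" UNIV U z] assms
    by (auto simp: open_fun_def)
  obtain m where m: "\<And>i. X i \<noteq> UNIV \<Longrightarrow> i < m"
    using finite_nat_set_iff_bounded X(2) by auto
  have "w \<in> U" if w: "\<forall>k<m. w k = z k" for w
  proof -
    have "w i \<in> X i" for i using w m[of i] X(1) by (cases "X i = UNIV") (auto simp: PiE_iff)
    then show ?thesis using X(3) by auto
  qed
  then show ?thesis by blast
qed

text \<open>Call a point of the closed set a condensation point if each of its neighbourhoods has uncountable
  image.  Only countably many points of the image lie in the image of some cylinder
  with countable image, so arbitrarily close to each condensation point \<open>z\<close> there are
  condensation points \<open>w\<close> with an image other than that of \<open>z\<close>.  Branching between \<open>z\<close> and such a \<open>w\<close>, with the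
  agreement increasing at every step, yields a tree of points along whose branches the points converge,
  and points on different branches have limits with different images.\<close>
lemma analytic_perfect_set:
  fixes A :: "('i \<Rightarrow> bool) set"
  assumes A: "analytic A" and unc: "uncountable A"
  shows "\<exists>g :: (nat \<Rightarrow> bool) \<Rightarrow> 'i \<Rightarrow> bool. inj g \<and> range g \<subseteq> A"
proof -
  obtain F and f :: "(nat \<Rightarrow> nat) \<Rightarrow> 'i \<Rightarrow> bool"
    where F: "closed F" and f: "continuous_on UNIV f" and A: "A = f ` F"
    using A unfolding analytic_def by blast
  define cyl where "cyl z m = {w \<in> F. \<forall>k<m. w k = z k}" for z :: "nat \<Rightarrow> nat" and m :: nat
  define cond where "cond z \<longleftrightarrow> z \<in> F \<and> (\<forall>m. uncountable (f ` cyl z m))" for z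
  define thin where "thin = (\<Union>z \<in> {z. \<exists>m. countable (f ` cyl z m)}. \<Union>m \<in> {m. countable (f ` cyl z m)}. f ` cyl z m)"
  \<comment> \<open>There are only countably many cylinders, as each is given by a finite list.\<close>
  have "countable thin"
  proof -
    define C where "C = (\<lambda>l :: nat list. {w \<in> F. \<forall>k<length l. w k = l ! k})"
    have "cyl z m = C (map z [0..<m])" for z m by (auto simp: cyl_def C_def)
    then have "thin \<subseteq> (\<Union>l \<in> {l. countable (f ` C l)}. f ` C l)"
      unfolding thin_def by auto
    moreover have "countable (\<Union>l \<in> {l. countable (f ` C l)}. f ` C l)"
      by (intro countable_UN countableI_type) auto
    ultimately show ?thesis using countable_subset by blast
  qed
  have cond_if: "cond w" if "w \<in> F" "f w \<notin> thin" for w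
  proof -
    have "f w \<in> f ` cyl w m" for m using that(1) by (auto simp: cyl_def)
    then show ?thesis using that unfolding cond_def thin_def by blast
  qed
  have split: "\<exists>w. cond w \<and> (\<forall>k<m. w k = z k) \<and> f w \<noteq> f z" if "cond z" for z m
  proof -
    have "uncountable (f ` cyl z m - (insert (f z) thin))"
      using that \<open>countable thin\<close> by (intro uncountable_minus_countable) (auto simp: cond_def)
    then have "f ` cyl z m - (insert (f z) thin) \<noteq> {}" by (metis countable_empty)
    then show ?thesis using cond_if by (auto simp: cyl_def)
  qed
  have separate: "\<exists>m'>m. \<forall>u v. (\<forall>k<m'. u k = z k) \<longrightarrow> (\<forall>k<m'. v k = w k) \<longrightarrow> f u \<noteq> f v"
    if zw: "f z \<noteq> f w" for z w and m :: nat
  proof -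
    obtain i where i: "f z i \<noteq> f w i" using zw by auto
    have op: "open {u. f u i = b}" for b
      using open_vimage[OF open_discrete[of "{b}"] continuous_on_product_then_coordinatewise[OF f, of i]]
      by (simp add: vimage_def)
    obtain m1 where m1: "\<And>u. (\<forall>k<m1. u k = z k) \<Longrightarrow> f u i = f z i"
      using open_contains_cylinder[OF op[of "f z i"], of z] by auto
    obtain m2 where m2: "\<And>u. (\<forall>k<m2. u k = w k) \<Longrightarrow> f u i = f w i"
      using open_contains_cylinder[OF op[of "f w i"], of w] by auto
    show ?thesis
    proof (intro exI[of _ "Suc (max m (max m1 m2))"] conjI allI impI)
      fix u v assume "\<forall>k<Suc (max m (max m1 m2)). u k = z k" "\<forall>k<Suc (max m (max m1 m2)). v k = w k"
      then have "f u i = f z i" "f v i = f w i" by (auto intro!: m1 m2)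
      then show "f u \<noteq> f v" using i by metis
    qed simp
  qed
  \<comment> \<open>Beyond making \<open>w\<close> close to \<open>z\<close>, the bound \<open>m'\<close> fixes so long an initial segment that all
    further refinements of \<open>z\<close> and of \<open>w\<close> keep different images.\<close>
  define good where "good z m w m' \<longleftrightarrow> (\<forall>k<m. w k = z k) \<and> m < m' \<and>
      (\<forall>u v. (\<forall>k<m'. u k = z k) \<longrightarrow> (\<forall>k<m'. v k = w k) \<longrightarrow> f u \<noteq> f v)" for z m w m'
  have "\<exists>w m'. cond z \<longrightarrow> cond w \<and> good z m w m'" for z m
  proof (cases "cond z")
    case True
    then obtain w where w: "cond w" "\<forall>k<m. w k = z k" "f z \<noteq> f w" using split by metis
    obtain m' where "m < m'"
      "\<forall>u v. (\<forall>k<m'. u k = z k) \<longrightarrow> (\<forall>k<m'. v k = w k) \<longrightarrow> f u \<noteq> f v"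
      using separate[OF w(3)] by blast
    with w show ?thesis unfolding good_def by blast
  qed simp
  then obtain alt len where alt_good: "\<And>z m. cond z \<longrightarrow> cond (alt z m) \<and> good z m (alt z m) (len z m)"
    by metis
  have alt: "cond (alt z m)" "k < m \<Longrightarrow> alt z m k = z k" "m < len z m"
      "\<lbrakk>\<forall>k<len z m. u k = z k; \<forall>k<len z m. v k = alt z m k\<rbrakk> \<Longrightarrow> f u \<noteq> f v"
    if "cond z" for z m k u v
    using alt_good[of z m] that by (simp_all add: good_def)
  obtain z0 where z0: "cond z0"
  proof -
    have "uncountable (A - thin)" using unc \<open>countable thin\<close> by (rule uncountable_minus_countable)
    then have "A - thin \<noteq> {}" by (metis countable_empty)
    then show ?thesis using that cond_if A by auto
  qed
  \<comment> \<open>A node is a condensation point with the length of the initial segment that all its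
    descendants share; bit \<open>s n\<close> tells whether the point is kept or replaced.\<close>
  define node where "node s = rec_nat (z0, 0)
      (\<lambda>n (z, m). (if s n then alt z m else z, len z m))" for s :: "nat \<Rightarrow> bool"
  define pt where "pt s n = fst (node s n)" for s n
  define lv where "lv s n = snd (node s n)" for s n
  have pt_0: "pt s 0 = z0" and lv_0: "lv s 0 = 0"
    and pt_Suc: "pt s (Suc n) = (if s n then alt (pt s n) (lv s n) else pt s n)"
    and lv_Suc: "lv s (Suc n) = len (pt s n) (lv s n)" for s n
    by (simp_all add: pt_def lv_def node_def split_beta)
  have pt: "cond (pt s n)" for s n
    by (induction n) (auto simp: pt_0 pt_Suc z0 alt)
  have lv_less: "lv s n < lv s (Suc n)" for s n
    using alt(3)[OF pt] by (simp add: lv_Suc)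
  have pt_step: "pt s (Suc n) k = pt s n k" if "k < lv s n" for s n k
    using that alt(2)[OF pt] by (simp add: pt_Suc)
  have lv_mono: "lv s n \<le> lv s (n + d)" for s n d
  proof (induction d)
    case (Suc d)
    then show ?case using lv_less[of s "n + d"] by simp
  qed simp
  have pt_stable: "pt s (n + d) k = pt s n k" if "k < lv s n" for s n d k
    using that
  proof (induction d)
    case (Suc d)
    then have "k < lv s (n + d)" using lv_mono[of s n d] by linarith
    then show ?case using Suc pt_step[of k s "n + d"] by simp
  qed simp
  have lv_ge: "n \<le> lv s n" for s n
  proof (induction n)
    case (Suc n)
    then show ?case using lv_less[of s n] by simp
  qed simp
  \<comment> \<open>The coordinate \<open>k\<close> is final from level \<open>Suc k\<close> on, since segments at level \<open>n\<close> have length at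
    least \<open>n\<close>.\<close>
  define lim where "lim s k = pt s (Suc k) k" for s k
  have lim: "lim s k = pt s n k" if "k < lv s n" for s n k
  proof (cases "Suc k \<le> n")
    case True
    then obtain d where "n = Suc k + d" using le_Suc_ex by blast
    then show ?thesis
      unfolding lim_def using pt_stable[of k s "Suc k" d] lv_ge[of "Suc k" s] by simp
  next
    case False
    then obtain d where "Suc k = n + d" using le_Suc_ex nat_le_linear by blast
    then show ?thesis unfolding lim_def using pt_stable[OF that] by simp
  qed
  have "lim s \<in> F" for s
  proof (rule ccontr)
    assume "lim s \<notin> F"
    then obtain m where m: "\<And>w. (\<forall>k<m. w k = lim s k) \<Longrightarrow> w \<notin> F"
      using open_contains_cylinder[of "- F" "lim s"] F by (auto simp: open_Compl)
    have "pt s m \<notin> F"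
      using lv_ge[of m s] by (intro m allI impI lim[symmetric]) simp
    then show False using pt[of s m] by (simp add: cond_def)
  qed
  moreover have "inj (\<lambda>s. f (lim s))"
  proof (rule injI, rule ccontr)
    fix s t assume eq: "f (lim s) = f (lim t)" and "s \<noteq> t"
    then obtain n' where "s n' \<noteq> t n'" by auto
    then obtain n where n: "s n \<noteq> t n" and before: "\<And>k. k < n \<Longrightarrow> s k = t k"
      using exists_least_iff[of "\<lambda>n. s n \<noteq> t n"] by blast
    have "pt s k = pt t k \<and> lv s k = lv t k" if "k \<le> n" for k
      using that by (induction k) (auto simp: pt_0 lv_0 pt_Suc lv_Suc before)
    then have same: "pt s n = pt t n" "lv s n = lv t n" by simp_all
    have "f (lim u) \<noteq> f (lim v)" if "u = s \<and> v = t \<or> u = t \<and> v = s" "\<not> u n" "v n" for u v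
    proof (rule alt(4)[OF pt[of u n], of "lv u n"])
      show "\<forall>k<len (pt u n) (lv u n). lim u k = pt u n k"
        using lim[of _ u "Suc n"] that by (simp add: pt_Suc lv_Suc)
      show "\<forall>k<len (pt u n) (lv u n). lim v k = alt (pt u n) (lv u n) k"
        using lim[of _ v "Suc n"] that same by (auto simp: pt_Suc lv_Suc)
    qed
    then show False using n eq by metis
  qed
  ultimately show ?thesis using A by (intro exI[of _ "\<lambda>s. f (lim s)"]) auto
qed

section \<open>Images of Borel sets under maps with countable fibres\<close>
lemma countable_iff_natLeq: "countable A \<longleftrightarrow> |A| \<le>o natLeq"
proof -
  have "countable A \<longleftrightarrow> |A| \<le>o |UNIV :: nat set|"
    unfolding countable_def card_of_ordLeq[symmetric] by simp
  then show ?thesis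
    using card_of_nat ordLeq_ordIso_trans ordIso_symmetric by blast
qed

text \<open>If \<open>X\<close> is uncountable, it has the cardinality of the continuum and is a union of \<open>|Q|\<close> countable
  sets; then \<open>Q\<close> is infinite and \<open>|X| \<le> |Q|\<close>.\<close>
lemma Borel_image_countable_or_continuum:
  assumes I: "countable I" "I \<noteq> {}" and X: "X \<in> sets (cantor I)"
    and Q: "Q = \<Phi> ` X" and fibre: "\<And>q. q \<in> Q \<Longrightarrow> countable {x \<in> X. \<Phi> x = q}"
  shows "countable Q \<or> |Q| =o |UNIV :: (nat \<Rightarrow> bool) set|"
proof (cases "countable X")
  case True
  then show ?thesis using Q by simp
next
  case False
  have X_eq: "X = (\<Union>q\<in>Q. {x \<in> X. \<Phi> x = q})" using Q by auto
  have inf: "infinite Q"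
  proof
    assume "finite Q"
    then have "countable (\<Union>q\<in>Q. {x \<in> X. \<Phi> x = q})"
      using fibre by (intro countable_UN) (auto intro: countable_finite)
    then show False using False X_eq by simp
  qed
  obtain g :: "(nat \<Rightarrow> bool) \<Rightarrow> _" where "inj g" "range g \<subseteq> X"
    using analytic_perfect_set[OF Borel_imp_analytic[OF I X] False] by blast
  then have "|UNIV :: (nat \<Rightarrow> bool) set| \<le>o |X|"
    using card_of_ordLeq by blast
  also have "|X| \<le>o |Q|"
  proof (subst X_eq, rule card_of_UNION_ordLeq_infinite[OF inf])
    show "|Q| \<le>o |Q|" by (rule card_of_mono1) simp
    have "natLeq \<le>o |Q|" using inf infinite_iff_natLeq_ordLeq by blast
    then show "\<forall>q\<in>Q. |{x \<in> X. \<Phi> x = q}| \<le>o |Q|"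
      using fibre countable_iff_natLeq ordLeq_transitive by blast
  qed
  finally have 1: "|UNIV :: (nat \<Rightarrow> bool) set| \<le>o |Q|" .
  have "inj_on (\<lambda>x k. x (from_nat_into I k)) X"
  proof (rule inj_onI)
    fix x y assume xy: "x \<in> X" "y \<in> X"
      and eq: "(\<lambda>k. x (from_nat_into I k)) = (\<lambda>k. y (from_nat_into I k))"
    have out: "\<not> x i \<and> \<not> y i" if "i \<notin> I" for i
      using that xy sets.sets_into_space[OF X] by (auto simp: space_cantor)
    have "x i = y i" if "i \<in> I" for i
      using fun_cong[OF eq, of "to_nat_on I i"] that I(1) by simp
    then show "x = y" using out by blast
  qed
  then have "|X| \<le>o |UNIV :: (nat \<Rightarrow> bool) set|"
    using card_of_ordLeq by blast
  then have "|Q| \<le>o |UNIV :: (nat \<Rightarrow> bool) set|"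
    unfolding Q using card_of_image ordLeq_transitive by blast
  with 1 show ?thesis using ordIso_iff_ordLeq by blast
qed

section \<open>Atomic diagrams\<close>

definition terms_in :: "('f, 'r) language \<Rightarrow> nat \<Rightarrow> 'f trm set" where
  "terms_in L n = {t. L_term L t \<and> tvars t \<subseteq> {..<n}}"

definition atoms :: "('f, 'r) language \<Rightarrow> nat \<Rightarrow> ('f, 'r) form set" where
  "atoms L n = {Eq s t | s t. s \<in> terms_in L n \<and> t \<in> terms_in L n} \<union>
     {Rel R ts | R ts. R \<in> rsyms L \<and> length ts = rarity L R \<and> set ts \<subseteq> terms_in L n}"

definition generated_by ::
    "('f, 'r) language \<Rightarrow> nat \<Rightarrow> ('f, 'r, 'u) fo_structure \<Rightarrow> 'u list \<Rightarrow> bool" where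
  "generated_by L n M a \<longleftrightarrow> length a = n \<and> set a \<subseteq> universe M \<and>
     universe M \<subseteq> teval M ((!) a) ` terms_in L n"

definition diagram ::
    "('f, 'r) language \<Rightarrow> nat \<Rightarrow> ('f, 'r, 'u) fo_structure \<Rightarrow> 'u list \<Rightarrow> ('f, 'r) form \<Rightarrow> bool" where
  "diagram L n M a = (\<lambda>p. p \<in> atoms L n \<and> sat M ((!) a) p)"

lemma n_generated_iff: "n_generated L n M \<longleftrightarrow> (\<exists>a. generated_by L n M a)"
  unfolding n_generated_def generated_by_def terms_in_def by blast

lemma Fn_in_terms_in:
  "\<lbrakk>f \<in> fsyms L; length ts = farity L f; set ts \<subseteq> terms_in L n\<rbrakk> \<Longrightarrow> Fn f ts \<in> terms_in L n"
  by (auto simp: terms_in_def)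

lemma countable_terms_in: "countable_language L \<Longrightarrow> countable (terms_in L n)"
  by (rule countable_subset[OF _ countable_L_terms[of L]]) (auto simp: terms_in_def)

lemma countable_atoms:
  assumes L: "countable_language L"
  shows "countable (atoms L n)"
proof -
  have "atoms L n \<subseteq> (\<lambda>(s, t). Eq s t) ` (terms_in L n \<times> terms_in L n) \<union>
      (\<lambda>(R, ts). Rel R ts) ` (rsyms L \<times> lists (terms_in L n))"
    by (auto simp: atoms_def)
  moreover have "countable \<dots>"
    using L countable_terms_in[OF L] by (auto simp: countable_language_def)
  ultimately show ?thesis by (rule countable_subset)
qed

lemma atoms_nonempty: "n \<ge> 1 \<Longrightarrow> atoms L n \<noteq> {}"
proof -
  assume "n \<ge> 1"
  then have "Eq (Var 0) (Var 0) \<in> atoms L n" by (simp add: atoms_def terms_in_def)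
  then show ?thesis by auto
qed

lemma teval_generators:
  assumes "L_structure L M" "generated_by L n M a" "t \<in> terms_in L n"
  shows "teval M ((!) a) t \<in> universe M"
proof (rule teval_in[OF assms(1)])
  show "L_term L t" using assms by (simp add: terms_in_def)
  fix i assume "i \<in> tvars t"
  then have "i < length a" using assms by (auto simp: terms_in_def generated_by_def)
  then show "a ! i \<in> universe M" using assms(2) nth_mem by (fastforce simp: generated_by_def)
qed

lemma diagram_Eq:
  "\<lbrakk>s \<in> terms_in L n; t \<in> terms_in L n\<rbrakk> \<Longrightarrow>
    diagram L n M a (Eq s t) \<longleftrightarrow> teval M ((!) a) s = teval M ((!) a) t"
  by (auto simp: diagram_def atoms_def)

lemma diagram_Rel:
  "\<lbrakk>R \<in> rsyms L; length ts = rarity L R; set ts \<subseteq> terms_in L n\<rbrakk> \<Longrightarrow>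
    diagram L n M a (Rel R ts) \<longleftrightarrow> rint M R (map (teval M ((!) a)) ts)"
  by (auto simp: diagram_def atoms_def)

lemma diagram_in_space: "diagram L n M a \<in> space (cantor (atoms L n))"
  by (simp add: diagram_def space_cantor)

text \<open>The isomorphism sends the value of a term at \<open>a\<close> to its value at \<open>b\<close>; the diagrams agree on
  equations, so this is well defined and injective, and it is surjective since \<open>b\<close> generates \<open>N\<close>.\<close>
lemma eq_diagrams_imp_isomorphic:
  fixes M :: "('f, 'r, 'u) fo_structure" and N :: "('f, 'r, 'v) fo_structure"
  assumes M: "L_structure L M" "generated_by L n M a" and N: "L_structure L N" "generated_by L n N b"
    and eq: "diagram L n M a = diagram L n N b"
  shows "isomorphic L M N"
proof -
  define r where "r x = (SOME t. t \<in> terms_in L n \<and> teval M ((!) a) t = x)" for x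
  have r: "r x \<in> terms_in L n" "teval M ((!) a) (r x) = x" if "x \<in> universe M" for x
  proof -
    have "\<exists>t. t \<in> terms_in L n \<and> teval M ((!) a) t = x"
      using that M(2) by (auto simp: generated_by_def)
    then have "r x \<in> terms_in L n \<and> teval M ((!) a) (r x) = x"
      unfolding r_def by (rule someI_ex)
    then show "r x \<in> terms_in L n" "teval M ((!) a) (r x) = x" by simp_all
  qed
  define h where "h x = teval N ((!) b) (r x)" for x
  have h: "h (teval M ((!) a) t) = teval N ((!) b) t" if t: "t \<in> terms_in L n" for t
  proof -
    note v = teval_generators[OF M t]
    have "diagram L n M a (Eq (r (teval M ((!) a) t)) t)"
      using r[OF v] t by (simp add: diagram_Eq)
    then show ?thesis using r[OF v] t by (simp add: eq diagram_Eq h_def)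
  qed
  have maps: "set (map r xs) \<subseteq> terms_in L n" "map (teval M ((!) a)) (map r xs) = xs"
      "map (teval N ((!) b)) (map r xs) = map h xs" if "set xs \<subseteq> universe M" for xs
    using that r by (induction xs) (auto simp: h_def)
  show ?thesis
    unfolding isomorphic_def
  proof (intro exI[of _ h] conjI ballI allI impI)
    have "inj_on h (universe M)"
    proof (rule inj_onI)
      fix x y assume xy: "x \<in> universe M" "y \<in> universe M" "h x = h y"
      then have "diagram L n N b (Eq (r x) (r y))" using r by (simp add: diagram_Eq h_def)
      then have "diagram L n M a (Eq (r x) (r y))" by (simp add: eq)
      then show "x = y" using r xy by (simp add: diagram_Eq)
    qed
    moreover have "h ` universe M \<subseteq> universe N"
      using teval_generators[OF N] r by (auto simp: h_def)
    moreover have "universe N \<subseteq> h ` universe M"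
    proof
      fix y assume "y \<in> universe N"
      then obtain t where t: "t \<in> terms_in L n" "y = teval N ((!) b) t"
        using N(2) by (auto simp: generated_by_def)
      then show "y \<in> h ` universe M" using h teval_generators[OF M] by (metis image_eqI)
    qed
    ultimately show "bij_betw h (universe M) (universe N)" by (simp add: bij_betw_def)
  next
    fix f xs assume f: "f \<in> fsyms L" "length xs = farity L f" "set xs \<subseteq> universe M"
    have "Fn f (map r xs) \<in> terms_in L n"
      using f maps(1)[OF f(3)] by (intro Fn_in_terms_in) simp_all
    from h[OF this] show "h (fint M f xs) = fint N f (map h xs)"
      unfolding teval.simps maps(2,3)[OF f(3)] .
  next
    fix R xs assume R: "R \<in> rsyms L" "length xs = rarity L R" "set xs \<subseteq> universe M"
    then have "diagram L n M a (Rel R (map r xs)) \<longleftrightarrow> rint M R xs"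
      using maps[OF R(3)] by (subst diagram_Rel) (simp_all del: map_map)
    moreover have "diagram L n N b (Rel R (map r xs)) \<longleftrightarrow> rint N R (map h xs)"
      using R maps[OF R(3)] by (subst diagram_Rel) (simp_all del: map_map)
    ultimately show "rint M R xs \<longleftrightarrow> rint N R (map h xs)" by (simp add: eq)
  qed
qed

lemma isomorphic_imp_eq_diagrams:
  fixes M :: "('f, 'r, 'u) fo_structure" and N :: "('f, 'r, 'v) fo_structure"
  assumes M: "L_structure L M" "generated_by L n M a" and iso: "isomorphic L M N"
  shows "\<exists>b. generated_by L n N b \<and> diagram L n N b = diagram L n M a"
proof -
  obtain h where h: "bij_betw h (universe M) (universe N)"
    and hf: "\<And>f xs. \<lbrakk>f \<in> fsyms L; length xs = farity L f; set xs \<subseteq> universe M\<rbrakk> \<Longrightarrow>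
        h (fint M f xs) = fint N f (map h xs)"
    and hr: "\<And>R xs. \<lbrakk>R \<in> rsyms L; length xs = rarity L R; set xs \<subseteq> universe M\<rbrakk> \<Longrightarrow>
        rint M R xs \<longleftrightarrow> rint N R (map h xs)"
    using iso unfolding isomorphic_def by blast
  have inj: "inj_on h (universe M)" and img: "h ` universe M = universe N"
    using h by (auto simp: bij_betw_def)
  note in_M = teval_generators[OF M]
  define b where "b = map h a"
  have te: "teval N ((!) b) t = h (teval M ((!) a) t)" if "t \<in> terms_in L n" for t
    using that
  proof (induction t)
    case (Var i)
    then show ?case using M(2) by (simp add: b_def terms_in_def generated_by_def)
  next
    case (Fn f ts)
    have ts: "set ts \<subseteq> terms_in L n" "f \<in> fsyms L" "length ts = farity L f"
      using Fn.prems by (auto simp: terms_in_def)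
    then have "h (fint M f (map (teval M ((!) a)) ts)) = fint N f (map h (map (teval M ((!) a)) ts))"
      using in_M by (intro hf) auto
    also have "map h (map (teval M ((!) a)) ts) = map (teval N ((!) b)) ts"
      using Fn.IH ts by auto
    finally show ?case by simp
  qed
  have "generated_by L n N b"
    unfolding generated_by_def
  proof (intro conjI)
    show "length b = n" "set b \<subseteq> universe N"
      using M(2) img by (auto simp: b_def generated_by_def)
    show "universe N \<subseteq> teval N ((!) b) ` terms_in L n"
      using M(2) te unfolding img[symmetric] generated_by_def by fastforce
  qed
  moreover have "diagram L n N b p = diagram L n M a p" for p
  proof (cases "p \<in> atoms L n")
    case True
    then consider s t where "p = Eq s t" "s \<in> terms_in L n" "t \<in> terms_in L n"
      | R ts where "p = Rel R ts" "R \<in> rsyms L" "length ts = rarity L R" "set ts \<subseteq> terms_in L n"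
      by (auto simp: atoms_def)
    then show ?thesis
    proof cases
      case 1
      then show ?thesis using te in_M inj_on_eq_iff[OF inj] by (simp add: diagram_Eq)
    next
      case 2
      have "map (teval N ((!) b)) ts = map h (map (teval M ((!) a)) ts)"
        using te 2(4) by auto
      moreover have "rint M R (map (teval M ((!) a)) ts) \<longleftrightarrow> rint N R (map h (map (teval M ((!) a)) ts))"
        using 2 in_M by (intro hr) auto
      ultimately show ?thesis unfolding 2(1) diagram_Rel[OF 2(2-4)] by (simp only:)
    qed
  qed (simp add: diagram_def)
  ultimately show ?thesis by (intro exI[of _ b]) (simp add: fun_eq_iff)
qed

section \<open>The term structure of a diagram\<close>

text \<open>The laws of equality.  They turn out to characterise atomic diagrams, by
  \<open>coherent_diagram\<close> and \<open>term_structure_generators\<close>.  Arguments range over countable sets of lists, so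
  that the condition is visibly Borel.\<close>
definition coherent :: "('f, 'r) language \<Rightarrow> nat \<Rightarrow> (('f, 'r) form \<Rightarrow> bool) \<Rightarrow> bool" where
  "coherent L n x \<longleftrightarrow>
     (\<forall>t\<in>terms_in L n. x (Eq t t)) \<and>
     (\<forall>s\<in>terms_in L n. \<forall>t\<in>terms_in L n. x (Eq s t) \<longrightarrow> x (Eq t s)) \<and>
     (\<forall>s\<in>terms_in L n. \<forall>t\<in>terms_in L n. \<forall>u\<in>terms_in L n. x (Eq s t) \<longrightarrow> x (Eq t u) \<longrightarrow> x (Eq s u)) \<and>
     (\<forall>f\<in>fsyms L. \<forall>ss\<in>{ss \<in> lists (terms_in L n). length ss = farity L f}.
        \<forall>ts\<in>{ts \<in> lists (terms_in L n). length ts = farity L f}.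
        (\<forall>i\<in>{..<farity L f}. x (Eq (ss ! i) (ts ! i))) \<longrightarrow> x (Eq (Fn f ss) (Fn f ts))) \<and>
     (\<forall>R\<in>rsyms L. \<forall>ss\<in>{ss \<in> lists (terms_in L n). length ss = rarity L R}.
        \<forall>ts\<in>{ts \<in> lists (terms_in L n). length ts = rarity L R}.
        (\<forall>i\<in>{..<rarity L R}. x (Eq (ss ! i) (ts ! i))) \<longrightarrow> x (Rel R ss) \<longrightarrow> x (Rel R ts))"

lemma coherent_diagram:
  fixes M :: "('f, 'r, 'u) fo_structure"
  shows "coherent L n (diagram L n M a)"
proof -
  let ?v = "teval M ((!) a)"
  have eqs: "map ?v ss = map ?v ts"
    if "set ss \<subseteq> terms_in L n" "set ts \<subseteq> terms_in L n" "length ss = k" "length ts = k"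
      "\<forall>i<k. diagram L n M a (Eq (ss ! i) (ts ! i))" for ss ts k
  proof (rule nth_equalityI)
    fix i assume "i < length (map ?v ss)"
    then have i: "i < length ss" "i < length ts" using that by auto
    then have "ss ! i \<in> terms_in L n" "ts ! i \<in> terms_in L n" using that nth_mem by blast+
    moreover have "diagram L n M a (Eq (ss ! i) (ts ! i))" using that(3,5) i by simp
    ultimately show "map ?v ss ! i = map ?v ts ! i" using i by (simp add: diagram_Eq)
  qed (use that in simp)
  show ?thesis
    unfolding coherent_def
  proof (intro conjI ballI impI)
    fix f ss ts
    assume f: "f \<in> fsyms L"
      and ss: "ss \<in> {ss \<in> lists (terms_in L n). length ss = farity L f}"
      and ts: "ts \<in> {ts \<in> lists (terms_in L n). length ts = farity L f}"
      and eq: "\<forall>i\<in>{..<farity L f}. diagram L n M a (Eq (ss ! i) (ts ! i))"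
    have "map ?v ss = map ?v ts" using ss ts eq by (intro eqs) (auto simp: in_lists_conv_set)
    moreover have "Fn f ss \<in> terms_in L n" "Fn f ts \<in> terms_in L n"
      using f ss ts by (auto intro!: Fn_in_terms_in)
    ultimately show "diagram L n M a (Eq (Fn f ss) (Fn f ts))" by (simp add: diagram_Eq)
  next
    fix R ss ts
    assume R: "R \<in> rsyms L"
      and ss: "ss \<in> {ss \<in> lists (terms_in L n). length ss = rarity L R}"
      and ts: "ts \<in> {ts \<in> lists (terms_in L n). length ts = rarity L R}"
      and eq: "\<forall>i\<in>{..<rarity L R}. diagram L n M a (Eq (ss ! i) (ts ! i))"
      and holds: "diagram L n M a (Rel R ss)"
    have "map ?v ss = map ?v ts" using ss ts eq by (intro eqs) (auto simp: in_lists_conv_set)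
    moreover have "rint M R (map ?v ss)" using holds by (simp add: diagram_def)
    ultimately show "diagram L n M a (Rel R ts)"
      using R ts by (subst diagram_Rel) (auto simp: in_lists_conv_set)
  qed (auto simp: diagram_Eq)
qed

definition term_class ::
    "('f, 'r) language \<Rightarrow> nat \<Rightarrow> (('f, 'r) form \<Rightarrow> bool) \<Rightarrow> 'f trm \<Rightarrow> 'f trm set" where
  "term_class L n x t = {s \<in> terms_in L n. x (Eq t s)}"

text \<open>The quotient of the terms by the equations in \<open>x\<close>.  Operations on classes go through chosen
  representatives; coherence makes the choice irrelevant.\<close>
definition term_structure ::
    "('f, 'r) language \<Rightarrow> nat \<Rightarrow> (('f, 'r) form \<Rightarrow> bool) \<Rightarrow> ('f, 'r, 'f trm set) fo_structure" where
  "term_structure L n x =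
     \<lparr>universe = term_class L n x ` terms_in L n,
      fint = (\<lambda>f cs. term_class L n x (Fn f (map (\<lambda>c. SOME t. t \<in> c) cs))),
      rint = (\<lambda>R cs. x (Rel R (map (\<lambda>c. SOME t. t \<in> c) cs)))\<rparr>"

primrec tsubst :: "(nat \<Rightarrow> 'f trm) \<Rightarrow> 'f trm \<Rightarrow> 'f trm" where
  "tsubst e (Var i) = e i"
| "tsubst e (Fn f ts) = Fn f (map (tsubst e) ts)"

lemma tsubst_in_terms_in:
  "\<lbrakk>L_term L t; \<And>i. i \<in> tvars t \<Longrightarrow> e i \<in> terms_in L n\<rbrakk> \<Longrightarrow> tsubst e t \<in> terms_in L n"
proof (induction t)
  case (Fn f ts)
  then show ?case unfolding tsubst.simps by (intro Fn_in_terms_in) auto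
qed simp

lemma tsubst_Var: "tsubst Var t = t"
  by (induction t) (simp_all add: map_idI)

context
  fixes L :: "('f, 'r) language" and n :: nat and x :: "('f, 'r) form \<Rightarrow> bool"
  assumes coherent: "coherent L n x"
begin

lemma coherent_refl: "t \<in> terms_in L n \<Longrightarrow> x (Eq t t)"
  using coherent unfolding coherent_def by (elim conjE) (rule bspec)

lemma coherent_sym: "\<lbrakk>x (Eq s t); s \<in> terms_in L n; t \<in> terms_in L n\<rbrakk> \<Longrightarrow> x (Eq t s)"
  by (rule coherent[unfolded coherent_def, THEN conjunct2, THEN conjunct1,
      THEN bspec, THEN bspec, THEN mp])

lemma coherent_trans:
  "\<lbrakk>x (Eq s t); x (Eq t u); s \<in> terms_in L n; t \<in> terms_in L n; u \<in> terms_in L n\<rbrakk> \<Longrightarrow> x (Eq s u)"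
  by (rule coherent[unfolded coherent_def, THEN conjunct2, THEN conjunct2, THEN conjunct1,
      THEN bspec, THEN bspec, THEN bspec, THEN mp, THEN mp])

lemma coherent_Fn:
  assumes f: "f \<in> fsyms L" and ss: "length ss = farity L f" "set ss \<subseteq> terms_in L n"
    and ts: "length ts = farity L f" "set ts \<subseteq> terms_in L n"
    and eq: "\<And>i. i < farity L f \<Longrightarrow> x (Eq (ss ! i) (ts ! i))"
  shows "x (Eq (Fn f ss) (Fn f ts))"
proof -
  have ss': "ss \<in> {ss \<in> lists (terms_in L n). length ss = farity L f}"
    and ts': "ts \<in> {ts \<in> lists (terms_in L n). length ts = farity L f}"
    using ss ts by (auto simp: in_lists_conv_set)
  have eq': "\<forall>i\<in>{..<farity L f}. x (Eq (ss ! i) (ts ! i))" using eq by simp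
  show ?thesis
    using coherent[unfolded coherent_def, THEN conjunct2, THEN conjunct2, THEN conjunct2, THEN conjunct1,
      THEN bspec, OF f, THEN bspec, OF ss', THEN bspec, OF ts', THEN mp, OF eq'] .
qed

lemma coherent_Rel:
  assumes R: "R \<in> rsyms L" and ss: "length ss = rarity L R" "set ss \<subseteq> terms_in L n"
    and ts: "length ts = rarity L R" "set ts \<subseteq> terms_in L n"
    and eq: "\<And>i. i < rarity L R \<Longrightarrow> x (Eq (ss ! i) (ts ! i))" and holds: "x (Rel R ss)"
  shows "x (Rel R ts)"
proof -
  have ss': "ss \<in> {ss \<in> lists (terms_in L n). length ss = rarity L R}"
    and ts': "ts \<in> {ts \<in> lists (terms_in L n). length ts = rarity L R}"
    using ss ts by (auto simp: in_lists_conv_set)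
  have eq': "\<forall>i\<in>{..<rarity L R}. x (Eq (ss ! i) (ts ! i))" using eq by simp
  show ?thesis
    using coherent[unfolded coherent_def, THEN conjunct2, THEN conjunct2, THEN conjunct2, THEN conjunct2,
      THEN bspec, OF R, THEN bspec, OF ss', THEN bspec, OF ts', THEN mp, OF eq', THEN mp, OF holds] .
qed

lemma term_class_eq_iff:
  assumes "s \<in> terms_in L n" "t \<in> terms_in L n"
  shows "term_class L n x s = term_class L n x t \<longleftrightarrow> x (Eq s t)"
proof
  assume eq: "term_class L n x s = term_class L n x t"
  have "t \<in> term_class L n x t"
    using assms by (simp add: coherent_refl term_class_def)
  then show "x (Eq s t)" unfolding eq[symmetric] by (simp add: term_class_def)
next
  assume st: "x (Eq s t)"
  show "term_class L n x s = term_class L n x t"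
    unfolding term_class_def using st assms coherent_sym coherent_trans by blast
qed

lemma term_class_representative:
  assumes "t \<in> terms_in L n"
  shows "(SOME s. s \<in> term_class L n x t) \<in> terms_in L n" "x (Eq (SOME s. s \<in> term_class L n x t) t)"
proof -
  have "t \<in> term_class L n x t"
    using assms by (simp add: coherent_refl term_class_def)
  then have "(SOME s. s \<in> term_class L n x t) \<in> term_class L n x t" by (rule someI)
  then show "(SOME s. s \<in> term_class L n x t) \<in> terms_in L n" "x (Eq (SOME s. s \<in> term_class L n x t) t)"
    unfolding term_class_def using assms coherent_sym by blast+
qed

lemma term_structure_fint:
  assumes f: "f \<in> fsyms L" "length ts = farity L f" "set ts \<subseteq> terms_in L n"
  shows "fint (term_structure L n x) f (map (term_class L n x) ts) = term_class L n x (Fn f ts)"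
proof -
  let ?ss = "map (\<lambda>t. SOME s. s \<in> term_class L n x t) ts"
  have ss: "set ?ss \<subseteq> terms_in L n" using f(3) term_class_representative(1) by auto
  have "x (Eq (Fn f ?ss) (Fn f ts))"
  proof (rule coherent_Fn[OF f(1) _ ss f(2,3)])
    fix i assume "i < farity L f"
    then show "x (Eq (?ss ! i) (ts ! i))"
      using f nth_mem[of i ts] term_class_representative(2)[of "ts ! i"] by (auto simp: subset_iff)
  qed (use f in simp)
  then have "term_class L n x (Fn f ?ss) = term_class L n x (Fn f ts)"
    using f ss by (subst term_class_eq_iff) (auto intro!: Fn_in_terms_in)
  then show ?thesis by (simp add: term_structure_def comp_def)
qed

lemma term_structure_rint:
  assumes R: "R \<in> rsyms L" "length ts = rarity L R" "set ts \<subseteq> terms_in L n"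
  shows "rint (term_structure L n x) R (map (term_class L n x) ts) \<longleftrightarrow> x (Rel R ts)"
proof -
  let ?ss = "map (\<lambda>t. SOME s. s \<in> term_class L n x t) ts"
  have ss: "set ?ss \<subseteq> terms_in L n" "length ?ss = rarity L R"
    using R term_class_representative(1) by auto
  have ss_ts: "x (Eq (?ss ! i) (ts ! i))" "x (Eq (ts ! i) (?ss ! i))" if "i < rarity L R" for i
  proof -
    have "ts ! i \<in> terms_in L n" using R nth_mem[of i ts] that by auto
    then show "x (Eq (?ss ! i) (ts ! i))" "x (Eq (ts ! i) (?ss ! i))"
      using term_class_representative[of "ts ! i"] coherent_sym R(2) that by simp_all
  qed
  have "x (Rel R ?ss) \<longleftrightarrow> x (Rel R ts)"
    using coherent_Rel[OF R(1) ss(2,1) R(2,3)] coherent_Rel[OF R(1,2,3) ss(2,1)] ss_ts by blast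
  then show ?thesis by (simp add: term_structure_def comp_def)
qed

text \<open>Evaluation in the term structure is substitution.  The assignment \<open>v\<close> is constrained at the
  variables of \<open>t\<close> alone, so that the lemma applies to the generating tuple, which gives values to the first \<open>n\<close>
  variables only.\<close>
lemma term_structure_teval:
  assumes "L_term L t" "\<And>i. i \<in> tvars t \<Longrightarrow> e i \<in> terms_in L n \<and> v i = term_class L n x (e i)"
  shows "teval (term_structure L n x) v t = term_class L n x (tsubst e t)"
  using assms
proof (induction t)
  case (Fn f ts)
  have "set (map (tsubst e) ts) \<subseteq> terms_in L n"
    using Fn.prems by (auto intro!: tsubst_in_terms_in)
  moreover have "map (teval (term_structure L n x) v) ts = map (term_class L n x) (map (tsubst e) ts)"
    using Fn by auto
  ultimately show ?case
    using Fn.prems term_structure_fint[of f "map (tsubst e) ts"] by (simp del: map_map)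
qed simp

lemma L_structure_term_structure:
  assumes "n \<ge> 1"
  shows "L_structure L (term_structure L n x)"
proof -
  have "Var 0 \<in> terms_in L n" using assms by (simp add: terms_in_def)
  moreover have "fint (term_structure L n x) f cs \<in> universe (term_structure L n x)"
    if f: "f \<in> fsyms L" "length cs = farity L f" "set cs \<subseteq> universe (term_structure L n x)" for f cs
  proof -
    have "cs \<in> lists (term_class L n x ` terms_in L n)"
      using f(3) by (auto simp: term_structure_def)
    then obtain ts where "cs = map (term_class L n x) ts" "set ts \<subseteq> terms_in L n"
      by (auto simp: lists_image in_lists_conv_set)
    then show ?thesis
      using f term_structure_fint[of f ts] Fn_in_terms_in[of f L ts n]
      by (simp add: term_structure_def)
  qed
  ultimately show ?thesis by (auto simp: L_structure_def term_structure_def)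
qed

lemma term_structure_generators:
  defines "g \<equiv> map (\<lambda>i. term_class L n x (Var i)) [0..<n]"
  shows "generated_by L n (term_structure L n x) g"
    and "x \<in> space (cantor (atoms L n)) \<Longrightarrow> diagram L n (term_structure L n x) g = x"
proof -
  have te: "teval (term_structure L n x) ((!) g) t = term_class L n x t" if "t \<in> terms_in L n" for t
    using that by (subst term_structure_teval[where e = Var]) (auto simp: terms_in_def g_def tsubst_Var)
  show "generated_by L n (term_structure L n x) g"
    unfolding generated_by_def
  proof (intro conjI)
    show "set g \<subseteq> universe (term_structure L n x)"
      by (auto simp: g_def term_structure_def terms_in_def)
    show "universe (term_structure L n x) \<subseteq> teval (term_structure L n x) ((!) g) ` terms_in L n"
      using te by (auto simp: term_structure_def)
  qed (simp add: g_def)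
  assume x: "x \<in> space (cantor (atoms L n))"
  have "diagram L n (term_structure L n x) g p = x p" for p
  proof (cases "p \<in> atoms L n")
    case True
    then consider s t where "p = Eq s t" "s \<in> terms_in L n" "t \<in> terms_in L n"
      | R ts where "p = Rel R ts" "R \<in> rsyms L" "length ts = rarity L R" "set ts \<subseteq> terms_in L n"
      by (auto simp: atoms_def)
    then show ?thesis
    proof cases
      case 1
      then show ?thesis by (simp add: diagram_Eq te term_class_eq_iff)
    next
      case 2
      have "map (teval (term_structure L n x) ((!) g)) ts = map (term_class L n x) ts"
        using te 2(4) by auto
      then show ?thesis unfolding 2(1) diagram_Rel[OF 2(2-4)] by (simp only: term_structure_rint[OF 2(2-4)])
    qed
  next
    case False
    then show ?thesis using x by (auto simp: diagram_def space_cantor)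
  qed
  then show "diagram L n (term_structure L n x) g = x" by (simp add: fun_eq_iff)
qed

end

section \<open>Being the diagram of a model is a Borel condition\<close>

text \<open>Formulas over a countable type of symbols are countably many; the formulas of a countable
  language embed into such a type by numbering the symbols.\<close>
instance trm :: (countable) countable
  by countable_datatype

instance form :: (countable, countable) countable
  by countable_datatype

lemma set_trm_subset: "L_term L t \<Longrightarrow> set_trm t \<subseteq> fsyms L"
  by (induction t) auto

lemma set_form_subset: "L_formula L p \<Longrightarrow> set1_form p \<subseteq> fsyms L \<and> set2_form p \<subseteq> rsyms L"
  by (induction p) (use set_trm_subset in fastforce)+

lemma countable_L_formulas:
  assumes L: "countable_language L"
  shows "countable {p. L_formula L p}"
proof -
  define code where "code = map_form (to_nat_on (fsyms L)) (to_nat_on (rsyms L))"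
  have inj: "inj_on (to_nat_on (fsyms L)) (fsyms L)" "inj_on (to_nat_on (rsyms L)) (rsyms L)"
    using L by (auto simp: countable_language_def)
  have "inj_on code {p. L_formula L p}"
  proof (rule inj_onI)
    fix p q assume pq: "p \<in> {p. L_formula L p}" "q \<in> {p. L_formula L p}" and eq: "code p = code q"
    have sub: "set1_form p \<subseteq> fsyms L" "set1_form q \<subseteq> fsyms L"
      "set2_form p \<subseteq> rsyms L" "set2_form q \<subseteq> rsyms L"
      using set_form_subset[of L] pq by simp_all
    show "p = q"
    proof (rule form.inj_map_strong[OF _ _ eq[unfolded code_def]])
      show "y = z" if "y \<in> set1_form p" "z \<in> set1_form q"
        "to_nat_on (fsyms L) y = to_nat_on (fsyms L) z" for y z
        using inj_onD[OF inj(1) that(3)] that(1,2) sub by blast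
      show "y = z" if "y \<in> set2_form p" "z \<in> set2_form q"
        "to_nat_on (rsyms L) y = to_nat_on (rsyms L) z" for y z
        using inj_onD[OF inj(2) that(3)] that(1,2) sub by blast
    qed
  qed
  then show ?thesis by (rule countableI')
qed

lemma sat_cong_free_vars:
  assumes "\<And>i. i \<in> free_vars p \<Longrightarrow> e i = e' i"
  shows "sat M e p = sat M e' p"
proof -
  have te: "teval M e t = teval M e' t" if "\<And>i. i \<in> tvars t \<Longrightarrow> e i = e' i" for e e' and t :: "'a trm"
    using that
  proof (induction t)
    case (Fn f ts)
    then have "map (teval M e) ts = map (teval M e') ts" by auto
    then show ?case by (simp only: teval.simps)
  qed simp
  show ?thesis
    using assms
  proof (induction p arbitrary: e e')
    case (Eq s t)
    then show ?case using te[of s e e'] te[of t e e'] by simp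
  next
    case (Rel R ts)
    have "map (teval M e) ts = map (teval M e') ts" using Rel by (auto intro!: te)
    then show ?case by (simp only: sat.simps)
  next
    case (Neg p)
    have "sat M e p = sat M e' p" using Neg.prems by (intro Neg.IH) simp
    then show ?case by simp
  next
    case (Conj p q)
    have "sat M e p = sat M e' p" using Conj.prems by (intro Conj.IH(1)) simp
    moreover have "sat M e q = sat M e' q" using Conj.prems by (intro Conj.IH(2)) simp
    ultimately show ?case by simp
  next
    case (Exist i p)
    have "sat M (e(i := u)) p = sat M (e'(i := u)) p" for u
      using Exist.prems by (intro Exist.IH) simp
    then show ?case by simp
  qed
qed

lemma coherent_Borel:
  assumes L: "countable_language L"
  shows "{x \<in> space (cantor (atoms L n)). coherent L n x} \<in> sets (cantor (atoms L n))"
proof -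
  have "countable {ts \<in> lists (terms_in L n). length ts = k}" for k
    by (rule countable_subset[OF _ countable_lists[OF countable_terms_in[OF L]]]) auto
  then show ?thesis
    unfolding coherent_def
    using countable_terms_in[OF L, of n] L[unfolded countable_language_def]
    by (intro sets.sets_Collect_conj sets.sets_Collect_countable_All' sets.sets_Collect_imp
        sets_cantor_coordinate) auto
qed

text \<open>Assignments are given by terms, not by elements, because the universe of the term structure varies
  with \<open>x\<close> while the terms do not; this is what makes the existential quantifier a countable union.  Coherence is
  part of the condition because it is what gives truth of atomic formulas in the structure its description by \<open>x\<close>.\<close>
lemma sat_term_structure_Borel:
  assumes L: "countable_language L" and "L_formula L p" "\<And>i. e i \<in> terms_in L n"
  shows "{x \<in> space (cantor (atoms L n)).
      coherent L n x \<and> sat (term_structure L n x) (\<lambda>i. term_class L n x (e i)) p} \<in> sets (cantor (atoms L n))"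
  using assms(2,3)
proof (induction p arbitrary: e)
  case (Eq s t)
  have "coherent L n x \<and> sat (term_structure L n x) (\<lambda>i. term_class L n x (e i)) (Eq s t) \<longleftrightarrow>
      coherent L n x \<and> x (Eq (tsubst e s) (tsubst e t))" for x
  proof (cases "coherent L n x")
    case True
    have "tsubst e s \<in> terms_in L n" "tsubst e t \<in> terms_in L n"
      using Eq by (auto intro!: tsubst_in_terms_in)
    then show ?thesis
      using Eq by (simp add: term_structure_teval[OF True, where e = e] term_class_eq_iff[OF True])
  qed simp
  then show ?case
    by (simp only:) (intro sets.sets_Collect_conj coherent_Borel[OF L] sets_cantor_coordinate)
next
  case (Rel R ts)
  have "coherent L n x \<and> sat (term_structure L n x) (\<lambda>i. term_class L n x (e i)) (Rel R ts) \<longleftrightarrow>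
      coherent L n x \<and> x (Rel R (map (tsubst e) ts))" for x
  proof (cases "coherent L n x")
    case True
    have "map (teval (term_structure L n x) (\<lambda>i. term_class L n x (e i))) ts =
        map (term_class L n x) (map (tsubst e) ts)"
      using Rel by (auto simp: term_structure_teval[OF True, where e = e])
    moreover have "rint (term_structure L n x) R (map (term_class L n x) (map (tsubst e) ts)) \<longleftrightarrow>
        x (Rel R (map (tsubst e) ts))"
      using Rel by (intro term_structure_rint[OF True]) (auto intro!: tsubst_in_terms_in)
    ultimately show ?thesis by (simp only: sat.simps)
  qed simp
  then show ?case
    by (simp only:) (intro sets.sets_Collect_conj coherent_Borel[OF L] sets_cantor_coordinate)
next
  case (Neg p)
  have "coherent L n x \<and> sat (term_structure L n x) (\<lambda>i. term_class L n x (e i)) (Neg p) \<longleftrightarrow>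
      coherent L n x \<and>
      \<not> (coherent L n x \<and> sat (term_structure L n x) (\<lambda>i. term_class L n x (e i)) p)" for x
    by auto
  then show ?case
    using Neg by (simp only:)
      (intro sets.sets_Collect_conj sets.sets_Collect_neg coherent_Borel[OF L] Neg.IH, simp_all)
next
  case (Conj p q)
  have "coherent L n x \<and> sat (term_structure L n x) (\<lambda>i. term_class L n x (e i)) (Conj p q) \<longleftrightarrow>
      (coherent L n x \<and> sat (term_structure L n x) (\<lambda>i. term_class L n x (e i)) p) \<and>
      (coherent L n x \<and> sat (term_structure L n x) (\<lambda>i. term_class L n x (e i)) q)" for x
    by auto
  then show ?case
    using Conj by (simp only:) (intro sets.sets_Collect_conj Conj.IH, simp_all)
next
  case (Exist j p)
  have upd: "(\<lambda>i. term_class L n x (e i))(j := term_class L n x t) =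
      (\<lambda>i. term_class L n x ((e(j := t)) i))" for x t
    by (simp add: fun_eq_iff)
  have "coherent L n x \<and> sat (term_structure L n x) (\<lambda>i. term_class L n x (e i)) (Exist j p) \<longleftrightarrow>
      (\<exists>t\<in>terms_in L n. coherent L n x \<and>
        sat (term_structure L n x) (\<lambda>i. term_class L n x ((e(j := t)) i)) p)" for x
    unfolding sat.simps upd[symmetric] by (auto simp: term_structure_def)
  moreover have "{x \<in> space (cantor (atoms L n)). \<exists>t\<in>terms_in L n. coherent L n x \<and>
        sat (term_structure L n x) (\<lambda>i. term_class L n x ((e(j := t)) i)) p} \<in> sets (cantor (atoms L n))"
    using Exist.prems
    by (intro sets.sets_Collect_countable_Ex' countable_terms_in[OF L] Exist.IH) auto
  ultimately show ?case by (simp only:)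
qed

text \<open>The members of \<open>T\<close> are sentences, so of all assignments, which are uncountably many in general,
  it suffices to test a single one.\<close>
lemma models_Borel:
  assumes L: "countable_language L" and n: "n \<ge> 1" and T: "L_theory L T"
  shows "{x \<in> space (cantor (atoms L n)). coherent L n x \<and> is_model L T (term_structure L n x)}
    \<in> sets (cantor (atoms L n))"
proof -
  have v0: "Var 0 \<in> terms_in L n" using n by (simp add: terms_in_def)
  have "coherent L n x \<and> is_model L T (term_structure L n x) \<longleftrightarrow>
      coherent L n x \<and> (\<forall>p\<in>T. coherent L n x \<and>
        sat (term_structure L n x) (\<lambda>i. term_class L n x (Var 0)) p)" for x
  proof (cases "coherent L n x")
    case True
    have indep: "sat (term_structure L n x) e p = sat (term_structure L n x) e' p" if "p \<in> T" for p e e'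
      using that T by (intro sat_cong_free_vars) (auto simp: L_theory_def L_sentence_def)
    have "range (\<lambda>i :: nat. term_class L n x (Var 0)) \<subseteq> universe (term_structure L n x)"
      using v0 by (auto simp: term_structure_def)
    then show ?thesis
      unfolding is_model_def using True L_structure_term_structure[OF True n] indep by blast
  qed simp
  moreover have "countable T"
    using T by (intro countable_subset[OF _ countable_L_formulas[OF L]]) (auto simp: L_theory_def L_sentence_def)
  then have "{x \<in> space (cantor (atoms L n)). coherent L n x \<and> (\<forall>p\<in>T. coherent L n x \<and>
        sat (term_structure L n x) (\<lambda>i. term_class L n x (Var 0)) p)} \<in> sets (cantor (atoms L n))"
    using T v0
    by (intro sets.sets_Collect_conj sets.sets_Collect_countable_All' coherent_Borel[OF L]
        sat_term_structure_Borel[OF L]) (auto simp: L_theory_def L_sentence_def)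
  ultimately show ?thesis by (simp only:)
qed

text \<open>Every diagram of a model is coherent, and its term structure is isomorphic to the model;
  conversely the term structure of a coherent \<open>x\<close> has diagram \<open>x\<close> and is countable, so that it has a copy with
  elements in \<open>'u\<close>.\<close>
lemma diagrams_of_models:
  assumes inf: "infinite (UNIV :: 'u set)" and L: "countable_language L" and n: "n \<ge> 1"
    and T: "L_theory L T"
  shows "{diagram L n M a | (M :: ('f, 'r, 'u) fo_structure) a. is_model L T M \<and> generated_by L n M a} =
    {x \<in> space (cantor (atoms L n)). coherent L n x \<and> is_model L T (term_structure L n x)}"
    (is "?D = ?X")
proof (intro equalityI subsetI)
  fix x assume "x \<in> ?D"
  then obtain M :: "('f, 'r, 'u) fo_structure" and a
    where M: "is_model L T M" "generated_by L n M a" and x: "x = diagram L n M a"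
    by blast
  have coh: "coherent L n x" and sp: "x \<in> space (cantor (atoms L n))"
    unfolding x by (rule coherent_diagram diagram_in_space)+
  have "isomorphic L M (term_structure L n x)"
    using M term_structure_generators[OF coh] sp
    by (intro eq_diagrams_imp_isomorphic[OF _ M(2) L_structure_term_structure[OF coh n]])
      (auto simp: is_model_def x)
  then show "x \<in> ?X" using iso_transfer(1)[OF T M(1)] coh sp by blast
next
  fix x assume x: "x \<in> ?X"
  then obtain g where g: "generated_by L n (term_structure L n x) g"
      "diagram L n (term_structure L n x) g = x"
    using term_structure_generators by blast
  have mod: "is_model L T (term_structure L n x)" using x by simp
  then obtain N :: "('f, 'r, 'u) fo_structure"
    where N: "is_model L T N" "isomorphic L (term_structure L n x) N"
    using n_generated_has_copy[OF inf L T] g(1) n_generated_iff by blast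
  then obtain b where "generated_by L n N b" "diagram L n N b = x"
    using isomorphic_imp_eq_diagrams[OF _ g(1) N(2)] mod g(2) by (auto simp: is_model_def)
  with N(1) show "x \<in> ?D" by blast
qed

section \<open>Counting isomorphism types\<close>
abbreviation iso_classes ::
    "('f, 'r) language \<Rightarrow> ('f, 'r, 'u) fo_structure set \<Rightarrow> ('f, 'r, 'u) fo_structure set set" where
  "iso_classes L K \<equiv> K // iso_rel L K"

lemma iso_classes_countable_or_continuum:
  fixes L :: "('f, 'r) language"
  assumes inf: "infinite (UNIV :: 'u set)" and L: "countable_language L" and n: "n \<ge> 1"
    and T: "L_theory L T"
  defines "K \<equiv> {M :: ('f, 'r, 'u) fo_structure. is_model L T M \<and> n_generated L n M}"
  shows "countable (iso_classes L K) \<or> |iso_classes L K| =o |UNIV :: (nat \<Rightarrow> bool) set|"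
proof -
  define X where "X = {diagram L n M a | (M :: ('f, 'r, 'u) fo_structure) a.
    is_model L T M \<and> generated_by L n M a}"
  \<comment> \<open>The isomorphism type with diagram \<open>x\<close>: diagrams determine the model up to isomorphism, hence no
    choice of a model for \<open>x\<close> is needed.\<close>
  define \<Phi> where "\<Phi> x = {N \<in> K. \<exists>b. generated_by L n N b \<and> diagram L n N b = x}" for x
  have struct: "L_structure L M" if "M \<in> K" for M
    using that by (simp add: K_def is_model_def)
  have \<Phi>: "\<Phi> (diagram L n M a) = iso_rel L K `` {M}" if M: "M \<in> K" "generated_by L n M a" for M a
  proof (intro equalityI subsetI)
    fix N assume "N \<in> \<Phi> (diagram L n M a)"
    then obtain b where N: "N \<in> K" "generated_by L n N b" "diagram L n M a = diagram L n N b"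
      by (auto simp: \<Phi>_def)
    have "isomorphic L M N"
      by (rule eq_diagrams_imp_isomorphic[OF struct[OF M(1)] M(2) struct[OF N(1)] N(2,3)])
    then show "N \<in> iso_rel L K `` {M}" using M N by (simp add: iso_rel_def)
  next
    fix N assume "N \<in> iso_rel L K `` {M}"
    then have "N \<in> K" "isomorphic L M N" by (auto simp: iso_rel_def)
    then show "N \<in> \<Phi> (diagram L n M a)"
      using isomorphic_imp_eq_diagrams[OF struct[OF M(1)] M(2)] by (auto simp: \<Phi>_def)
  qed
  have X: "X \<in> sets (cantor (atoms L n))"
    unfolding X_def diagrams_of_models[OF inf L n T] by (rule models_Borel[OF L n T])
  have Q: "iso_classes L K = \<Phi> ` X"
  proof (intro equalityI subsetI)
    fix q assume "q \<in> iso_classes L K"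
    then obtain M where M: "M \<in> K" "q = iso_rel L K `` {M}" by (rule quotientE)
    then obtain a where a: "generated_by L n M a" by (auto simp: K_def n_generated_iff)
    have "diagram L n M a \<in> X" using M a by (auto simp: X_def K_def)
    then show "q \<in> \<Phi> ` X" using \<Phi>[OF M(1) a] M(2) by blast
  next
    fix q assume "q \<in> \<Phi> ` X"
    then obtain M :: "('f, 'r, 'u) fo_structure" and a where "is_model L T M" "generated_by L n M a" "q = \<Phi> (diagram L n M a)"
      unfolding X_def by blast
    moreover from this have "M \<in> K" by (auto simp: K_def n_generated_iff)
    ultimately show "q \<in> iso_classes L K" using \<Phi> quotientI by metis
  qed
  have fibre: "countable {x \<in> X. \<Phi> x = q}" if q: "q \<in> iso_classes L K" for q
  proof -
    obtain M where M: "M \<in> K" "q = iso_rel L K `` {M}" using q by (rule quotientE)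
    have "M \<in> q" using M iso_refl by (simp add: iso_rel_def)
    then have sub: "{x \<in> X. \<Phi> x = q} \<subseteq> diagram L n M ` lists (universe M)"
      by (auto simp: \<Phi>_def generated_by_def in_lists_conv_set)
    have "countable (universe M)"
    proof -
      obtain a where "universe M \<subseteq> teval M ((!) a) ` terms_in L n"
        using M(1) by (auto simp: K_def n_generated_iff generated_by_def)
      then show ?thesis by (rule countable_subset[OF _ countable_image[OF countable_terms_in[OF L]]])
    qed
    then show ?thesis
      by (intro countable_subset[OF sub] countable_image countable_lists)
  qed
  show ?thesis
    by (rule Borel_image_countable_or_continuum[OF countable_atoms[OF L] atoms_nonempty[OF n] X Q fibre])
qed

lemma continuum_eq: "ctwo ^c natLeq = |UNIV :: (nat \<Rightarrow> bool) set|"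
proof -
  have "Func (UNIV :: nat set) (UNIV :: bool set) = UNIV" by (auto simp: Func_def)
  then show ?thesis by (simp add: cexp_def ctwo_def Field_natLeq Field_card_of)
qed

theorem theorem2p1:
  fixes L :: "('f, 'r) language" and T :: "('f, 'r) form set" and n :: nat
  assumes "infinite (UNIV :: 'u set)"
    and "countable_language L" and "n \<ge> 1" and "L_theory L T"
  shows "((alpha_n L n T :: ('f, 'r, 'u) fo_structure set rel) \<le>o natLeq
            \<or> (alpha_n L n T :: ('f, 'r, 'u) fo_structure set rel) =o ctwo ^c natLeq)
       \<and> ((alpha L T :: ('f, 'r, 'u) fo_structure set rel) \<le>o natLeq
            \<or> (alpha L T :: ('f, 'r, 'u) fo_structure set rel) =o ctwo ^c natLeq)"
proof -
  let ?C = "|UNIV :: (nat \<Rightarrow> bool) set|"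
  define K where "K n = {M :: ('f, 'r, 'u) fo_structure. is_model L T M \<and> n_generated L n M}" for n
  define Kfg where "Kfg = {M :: ('f, 'r, 'u) fo_structure. is_model L T M \<and> finitely_generated L M}"
  have dich: "countable (iso_classes L (K m)) \<or> |iso_classes L (K m)| =o ?C" if "m \<ge> 1" for m
    unfolding K_def by (rule iso_classes_countable_or_continuum[OF assms(1,2) that assms(4)])
  \<comment> \<open>Being \<open>m\<close>-generated is invariant under isomorphism, so the class of an \<open>m\<close>-generated model is the
    same within the \<open>m\<close>-generated and within all finitely generated models.\<close>
  have cls: "iso_rel L Kfg `` {M} = iso_rel L (K m) `` {M}" if "M \<in> K m" "m \<ge> 1" for M m
    using that iso_transfer(2)[OF assms(4)] iso_transfer(1)[OF assms(4)]
    by (auto simp: iso_rel_def K_def Kfg_def finitely_generated_def)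
  have Kfg: "Kfg = (\<Union>m\<in>{1..}. K m)"
    by (auto simp: Kfg_def K_def finitely_generated_def)
  have union: "iso_classes L Kfg = (\<Union>m\<in>{1..}. iso_classes L (K m))"
    unfolding quotient_def using cls by (auto simp: Kfg)
  have fg: "countable (iso_classes L Kfg) \<or> |iso_classes L Kfg| =o ?C"
  proof (cases "\<forall>m\<ge>1. countable (iso_classes L (K m))")
    case True
    then show ?thesis unfolding union by auto
  next
    case False
    then obtain m where m: "m \<ge> 1" "|iso_classes L (K m)| =o ?C" using dich by blast
    have inf: "infinite (UNIV :: (nat \<Rightarrow> bool) set)"
      by (simp add: finite_UNIV_fun infinite_UNIV_nat)
    have nat: "natLeq \<le>o ?C"
      using inf infinite_iff_natLeq_ordLeq by blast
    have "?C \<le>o |iso_classes L Kfg|"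
    proof -
      have "?C =o |iso_classes L (K m)|" using m(2) by (rule ordIso_symmetric)
      moreover have "|iso_classes L (K m)| \<le>o |iso_classes L Kfg|"
        using m(1) unfolding union by (intro card_of_mono1) auto
      ultimately show ?thesis by (rule ordIso_ordLeq_trans)
    qed
    moreover have "|iso_classes L Kfg| \<le>o ?C"
      unfolding union
    proof (rule card_of_UNION_ordLeq_infinite[OF inf])
      show "|{1 :: nat..}| \<le>o ?C"
        using nat countable_iff_natLeq[of "{1 :: nat..}"] ordLeq_transitive by blast
      show "\<forall>k\<in>{1..}. |iso_classes L (K k)| \<le>o ?C"
      proof
        fix k :: nat assume "k \<in> {1..}"
        then consider "countable (iso_classes L (K k))" | "|iso_classes L (K k)| =o ?C"
          using dich by force
        then show "|iso_classes L (K k)| \<le>o ?C"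
          by cases (use nat countable_iff_natLeq ordLeq_transitive ordIso_imp_ordLeq in blast)+
      qed
    qed
    ultimately show ?thesis using ordIso_iff_ordLeq by blast
  qed
  show ?thesis
    using dich[OF assms(3)] fg
    unfolding alpha_n_def alpha_def Let_def continuum_eq countable_iff_natLeq K_def Kfg_def by blast
qed

end
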